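(* Let $f:\mathbb{R}^d\to\mathbb{R}$ be bounded from below by $f^*:=\min_{x\in\mathbb{R}^d}f(x)$ and differentiable with $L$-Lipschitz gradient, i.e. $\|\nabla f(x)-\nabla f(y)\|\le L\|x-y\|$ for all $x,y\in\mathbb{R}^d$. Suppose the stochastic gradients are unbiased and their noise is uniformly bounded by $\sigma_g\ge 0$ (as made precise in the context), let $q>\sigma_g$ with $q>0$, let $\beta\in[0,1)$, and let the positive step sizes $\{\alpha_t\}_{t\ge1}$ satisfy $$\sum_{t=1}^{\infty}\alpha_t=\infty,\qquad\sum_{t=1}^{\infty}\alpha_t^2<\infty.$$ Let $\{x_t\}$ be the iterates of any one of the following three methods: (i) SGD-CN: $x_{t+1}=x_t-\alpha_t g_t^{CN}$; (ii) SHB-CN: $x_{t+1}=x_t-\alpha_t g_t^{CN}+\beta(x_t-x_{t-1})$; (iii) SNAG-CN: $y_{t+1}=x_t-\alpha_t g_t^{CN}$, $\;x_{t+1}=y_{t+1}+\beta(y_{t+1}-y_t)$; for $t\ge1$. Then $$\|\nabla f(x_t)\|\to0\quad\text{a.s. as } t\to\infty.$$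
   Context: $\|\cdot\|$ is the Euclidean norm on $\mathbb{R}^d$. Stochastic gradient oracle: $\nabla f(x;\xi)$ denotes a (measurable) stochastic gradient at $x$ with random sample $\xi$; at step $t$ a random sample $\xi_t$ is drawn. Clipping: for $q>0$ and $v\in\mathbb{R}^d$, $\mathrm{clip}_q(v):=\min(1,q/\|v\|)\,v$ (with $\mathrm{clip}_q(0)=0$). Clipped noisy stochastic gradient: $g_t^{CN}:=\mathrm{clip}_q(\nabla f(x_t;\xi_t))+q\zeta_t$, where $\zeta_t\sim\mathcal{N}(0,\sigma_{CN}^2 I)$ is zero-mean Gaussian noise in $\mathbb{R}^d$ with variance parameter $\sigma_{CN}^2$, independent of the past and of $\xi_t$. Filtration: $\mathcal{F}_t$ is the natural filtration, i.e. the $\sigma$-algebra generated by the initialization and $\xi_1,\dots,\xi_{t-1},\zeta_1,\dots,\zeta_{t-1}$. Initialization is $\mathcal{F}_1$-measurable: $x_1$ for SGD-CN; $x_0,x_1$ for SHB-CN; $y_0,y_1$ with $x_1=y_1+\beta(y_1-y_0)$ for SNAG-CN. Hence $x_t$ is $\mathcal{F}_t$-measurable. Unbiasedness: $\mathbb{E}[\nabla f(x_t;\xi_t)\mid\mathcal{F}_t]=\nabla f(x_t)$ for all $t$. Uniformly bounded noise: $\|\nabla f(x;\xi)-\nabla f(x)\|\le\sigma_g$ almost surely for every $x\in\mathbb{R}^d$; in particular $\|\nabla f(x_t;\xi_t)-\nabla f(x_t)\|\le\sigma_g$ a.s. for every $t$. Step sizes are deterministic. *)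

theory Defs
  imports "HOL-Probability.Probability"
begin

text \<open>At \<open>v = 0\<close> the convention \<open>q / 0 = 0\<close> gives \<open>clip q 0 = 0\<close>.\<close>

definition clip :: "real \<Rightarrow> real ^ 'd \<Rightarrow> real ^ 'd" where
  "clip q v = min 1 (q / norm v) *\<^sub>R v"

text \<open>The law of \<open>s Z\<close>, where \<open>Z\<close> has independent standard normal coordinates, that is
  \<open>N(0, s\<^sup>2 I)\<close>; for \<open>s = 0\<close> it is the point mass at the origin.\<close>

definition isotropic_gaussian :: "real \<Rightarrow> (real ^ 'd) measure" where
  "isotropic_gaussian s =
     distr (\<Pi>\<^sub>M i\<in>(UNIV :: 'd set). density lborel (\<lambda>u. ennreal (std_normal_density u))) borel
       (\<lambda>z. s *\<^sub>R (\<chi> i. z i))"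

text \<open>\<open>real_cond_exp\<close> is the difference of the conditional expectations of the positive and
  negative parts, so \<open>X\<close> need not be integrable as long as both of these are finite a.s.\<close>

definition vec_cond_exp :: "'w measure \<Rightarrow> 'w measure \<Rightarrow> ('w \<Rightarrow> real ^ 'd) \<Rightarrow> 'w \<Rightarrow> real ^ 'd" where
  "vec_cond_exp M F X \<omega> = (\<chi> i. real_cond_exp M F (\<lambda>\<omega>'. X \<omega>' $ i) \<omega>)"

text \<open>\<open>I\<close> is the set of random vectors initializing the method.\<close>

definition natural_filtration ::
    "'w measure \<Rightarrow> 's measure \<Rightarrow> ('w \<Rightarrow> real ^ 'd) set \<Rightarrow> (nat \<Rightarrow> 'w \<Rightarrow> 's) \<Rightarrow>
     (nat \<Rightarrow> 'w \<Rightarrow> real ^ 'd) \<Rightarrow> nat \<Rightarrow> 'w measure" where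
  "natural_filtration M S I \<xi> \<zeta> t =
     sigma (space M)
       ((\<Union>Z\<in>I. sets (vimage_algebra (space M) Z borel)) \<union>
        (\<Union>s\<in>{1..<t}. sets (vimage_algebra (space M) (\<xi> s) S)) \<union>
        (\<Union>s\<in>{1..<t}. sets (vimage_algebra (space M) (\<zeta> s) borel)))"

definition past_and_sample ::
    "'w measure \<Rightarrow> 's measure \<Rightarrow> ('w \<Rightarrow> real ^ 'd) set \<Rightarrow> (nat \<Rightarrow> 'w \<Rightarrow> 's) \<Rightarrow>
     (nat \<Rightarrow> 'w \<Rightarrow> real ^ 'd) \<Rightarrow> nat \<Rightarrow> 'w measure" where
  "past_and_sample M S I \<xi> \<zeta> t =
     sigma (space M)
       (sets (natural_filtration M S I \<xi> \<zeta> t) \<union>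
        sets (vimage_algebra (space M) (\<xi> t) S))"

definition clipped_noisy_grad ::
    "real \<Rightarrow> (real ^ 'd \<Rightarrow> 's \<Rightarrow> real ^ 'd) \<Rightarrow> (nat \<Rightarrow> 'w \<Rightarrow> 's) \<Rightarrow> (nat \<Rightarrow> 'w \<Rightarrow> real ^ 'd) \<Rightarrow>
     (nat \<Rightarrow> 'w \<Rightarrow> real ^ 'd) \<Rightarrow> 'w \<Rightarrow> nat \<Rightarrow> real ^ 'd" where
  "clipped_noisy_grad q G \<xi> \<zeta> x \<omega> t = clip q (G (x t \<omega>) (\<xi> t \<omega>)) + q *\<^sub>R \<zeta> t \<omega>"

text \<open>The three recursions, for a single sample path. The sequence \<open>g\<close> will be the clipped noisy
  gradients evaluated along \<open>x\<close> itself. Only indices \<open>t \<ge> 1\<close> are constrained by \<open>sgd\<close>;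
  \<open>shb\<close> also uses \<open>x 0\<close>, and \<open>snag\<close> uses \<open>y 0\<close>, \<open>y 1\<close> but not \<open>x 0\<close>.\<close>

definition sgd :: "(nat \<Rightarrow> real) \<Rightarrow> (nat \<Rightarrow> real ^ 'd) \<Rightarrow> (nat \<Rightarrow> real ^ 'd) \<Rightarrow> bool" where
  "sgd \<alpha> g x \<longleftrightarrow> (\<forall>t\<ge>1. x (t + 1) = x t - \<alpha> t *\<^sub>R g t)"

definition shb ::
    "(nat \<Rightarrow> real) \<Rightarrow> real \<Rightarrow> (nat \<Rightarrow> real ^ 'd) \<Rightarrow> (nat \<Rightarrow> real ^ 'd) \<Rightarrow> bool" where
  "shb \<alpha> \<beta> g x \<longleftrightarrow> (\<forall>t\<ge>1. x (t + 1) = x t - \<alpha> t *\<^sub>R g t + \<beta> *\<^sub>R (x t - x (t - 1)))"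

definition snag ::
    "(nat \<Rightarrow> real) \<Rightarrow> real \<Rightarrow> (nat \<Rightarrow> real ^ 'd) \<Rightarrow> (nat \<Rightarrow> real ^ 'd) \<Rightarrow>
     (nat \<Rightarrow> real ^ 'd) \<Rightarrow> bool" where
  "snag \<alpha> \<beta> g x y \<longleftrightarrow>
     x 1 = y 1 + \<beta> *\<^sub>R (y 1 - y 0) \<and>
     (\<forall>t\<ge>1. y (t + 1) = x t - \<alpha> t *\<^sub>R g t \<and>
            x (t + 1) = y (t + 1) + \<beta> *\<^sub>R (y (t + 1) - y t))"

end

theory Submission
  imports Defs
begin

text \<open>With \<open>n\<^sub>t = \<nabla>f(x\<^sub>t; \<xi>\<^sub>t) - \<nabla>f(x\<^sub>t)\<close>, split the clipped noisy gradient as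
  \<open>b\<^sub>t + D\<^sub>t\<close>, where \<open>D\<^sub>t = n\<^sub>t + q \<zeta>\<^sub>t\<close> is a martingale difference and
  \<open>b\<^sub>t = clip\<^sub>q(\<nabla>f(x\<^sub>t) + n\<^sub>t) - n\<^sub>t\<close> is bounded. Although \<open>b\<^sub>t\<close> is random, the inequality
  \<open>\<langle>\<nabla>f(x\<^sub>t), b\<^sub>t\<rangle> \<ge> \<kappa> min (A\<^sub>t\<^sup>2, A\<^sub>t)\<close> with \<open>A\<^sub>t = \<parallel>\<nabla>f(x\<^sub>t)\<parallel>\<close> holds pathwise, because \<open>\<sigma>\<^sub>g < q\<close>;
  so the bias of clipping never has to be computed.

  All three methods have the form \<open>z\<^sub>t\<^sub>+\<^sub>1 = z\<^sub>t - c \<alpha>\<^sub>t g\<^sub>t\<close>, \<open>m\<^sub>t\<^sub>+\<^sub>1 = \<beta> m\<^sub>t - \<alpha>\<^sub>t g\<^sub>t\<close>,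
  \<open>x\<^sub>t = z\<^sub>t - c' m\<^sub>t\<close>. Taking expectations in the descent inequality for the Lyapunov function
  \<open>f(z) - f\<^sup>* + \<Lambda> \<parallel>m\<parallel>\<^sup>2\<close>, restricted to the events on which it is initially at most \<open>k\<close>, gives
  \<open>\<Sum>\<alpha>\<^sub>t min (A\<^sub>t\<^sup>2, A\<^sub>t) < \<infinity>\<close> a.s. Finally \<open>\<Sum>\<alpha>\<^sub>t D\<^sub>t\<close> converges a.s. as an
  \<open>L\<^sup>2\<close>-bounded martingale, so asymptotically \<open>x\<close> moves by at most a multiple of the sum of the
  steps, and repeated excursions of \<open>A\<close> away from 0 would make the former series diverge.\<close>

section \<open>Clipping\<close>

text \<open>Without clipping the inner product is exactly \<open>A\<^sup>2\<close>. With clipping it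
  equals \<open>q / N * (A\<^sup>2 + p) - p\<close>, where \<open>p = inner a n\<close> and
  \<open>N = norm (a + n)\<close>, and the sign of \<open>p\<close> decides how it is bounded. Both
  regimes give at least \<open>min (A\<^sup>2) ((q - \<sigma>) * A\<^sup>2 / (A +
  \<sigma>))\<close>, from which the stated constant follows.\<close>

lemma clip_inner_lower_bound:
  fixes a n :: "real ^ 'd"
  assumes n: "norm n \<le> \<sigma>" and \<sigma>: "\<sigma> < q"
  shows "min 1 ((q - \<sigma>) / (1 + \<sigma>)) * min ((norm a)\<^sup>2) (norm a) \<le> inner a (clip q (a + n) - n)"
proof -
  define A where "A = norm a"
  define p where "p = inner a n"
  define v where "v = inner a (clip q (a + n) - n)"
  have A0: "0 \<le> A" by (simp add: A_def)
  have s0: "0 \<le> \<sigma>" and q0: "0 < q"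
    using norm_ge_zero[of n] n \<sigma> by linarith+
  have an: "inner a (a + n) = A\<^sup>2 + p"
    by (simp add: A_def p_def inner_add_right power2_norm_eq_inner)
  have gsq: "(norm (a + n))\<^sup>2 = A\<^sup>2 + 2 * p + (norm n)\<^sup>2"
    by (simp add: A_def p_def power2_norm_eq_inner inner_add_left inner_add_right inner_commute)
  have g_le: "norm (a + n) \<le> A + \<sigma>"
    using norm_triangle_ineq[of a n] n by (simp add: A_def)
  have p_le: "p \<le> A * \<sigma>"
    using norm_cauchy_schwarz[of a n] n mult_left_mono[OF n A0] by (simp add: A_def p_def)
  have "min (A\<^sup>2) ((q - \<sigma>) * A\<^sup>2 / (A + \<sigma>)) \<le> v"
  proof (cases "norm (a + n) \<le> q")
    case True
    then have "clip q (a + n) = a + n"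
      by (cases "a + n = 0") (auto simp: clip_def min_def field_simps)
    then have "v = A\<^sup>2"
      by (simp add: v_def A_def power2_norm_eq_inner)
    then show ?thesis by simp
  next
    case False
    define N where "N = norm (a + n)"
    have N: "q < N" "0 < N" "N \<le> A + \<sigma>" using False q0 g_le by (auto simp: N_def)
    have "clip q (a + n) = (q / N) *\<^sub>R (a + n)"
      using N by (simp add: clip_def N_def min_def)
    then have v: "v = q / N * (A\<^sup>2 + p) - p"
      by (simp add: v_def inner_diff_right an p_def)
    have l1: "q / N \<le> 1" and l0: "0 < q / N" using N q0 by auto
    consider "p \<le> - A\<^sup>2" | "- A\<^sup>2 \<le> p" "p \<le> 0" | "0 < p" by linarith
    then show ?thesis
    proof cases
      case 1
      have "(1 - q / N) * (A\<^sup>2 + p) \<le> 0"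
        using 1 l1 by (intro mult_nonneg_nonpos) auto
      then have "A\<^sup>2 \<le> v" by (simp add: v algebra_simps)
      then show ?thesis by simp
    next
      case 2
      \<comment> \<open>Here \<open>A\<^sup>2 + p\<close> is nonnegative, so \<open>q / N\<close>
        may be lowered to \<open>\<mu>\<close>. Then \<open>v\<close> is at least
        \<open>\<mu> * A\<^sup>2 + (1 - \<mu>) * (- p)\<close>, whose second term is
        nonnegative.\<close>
      define \<mu> where "\<mu> = q / (A + \<sigma>)"
      have "\<mu> \<le> q / N" unfolding \<mu>_def using N q0 by (intro divide_left_mono) auto
      then have "\<mu> * (A\<^sup>2 + p) \<le> q / N * (A\<^sup>2 + p)" using 2 by (intro mult_right_mono) auto
      moreover have "\<mu> \<le> 1" using N q0 by (simp add: \<mu>_def)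
      then have "0 \<le> (1 - \<mu>) * (- p)" using 2 by (intro mult_nonneg_nonneg) auto
      ultimately have "\<mu> * A\<^sup>2 \<le> v" by (simp add: v algebra_simps)
      moreover have "(q - \<sigma>) * A\<^sup>2 / (A + \<sigma>) \<le> \<mu> * A\<^sup>2"
        using N s0 by (auto simp: \<mu>_def intro!: divide_right_mono mult_right_mono)
      ultimately show ?thesis by linarith
    next
      case 3
      \<comment> \<open>\<open>X\<close> is the component of \<open>a\<close> along the direction of
        \<open>a + n\<close>, and \<open>v = q * X - p\<close>. So the aim is
        \<open>p \<le> \<sigma> * X\<close>, that is
        \<open>p * N \<le> \<sigma> * (A\<^sup>2 + p)\<close>, which is proved by comparing
        squares.\<close>
      define X where "X = (A\<^sup>2 + p) / N"
      have X0: "0 \<le> X" using 3 N by (simp add: X_def)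
      have "p\<^sup>2 \<le> (A * \<sigma>)\<^sup>2" using 3 p_le by (intro power_mono) auto
      then have p2: "p\<^sup>2 \<le> A\<^sup>2 * \<sigma>\<^sup>2" by (simp add: power_mult_distrib)
      have "(norm n)\<^sup>2 \<le> \<sigma>\<^sup>2" using n by (intro power_mono) auto
      then have "(p * N)\<^sup>2 \<le> p\<^sup>2 * (A\<^sup>2 + 2 * p + \<sigma>\<^sup>2)"
        unfolding power_mult_distrib N_def gsq by (intro mult_left_mono) auto
      also have "\<dots> = p\<^sup>2 * (A\<^sup>2 + 2 * p) + p\<^sup>2 * \<sigma>\<^sup>2" by (simp add: algebra_simps)
      also have "\<dots> \<le> A\<^sup>2 * \<sigma>\<^sup>2 * (A\<^sup>2 + 2 * p) + p\<^sup>2 * \<sigma>\<^sup>2"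
        using 3 p2 by (intro add_right_mono mult_right_mono) auto
      also have "\<dots> = (\<sigma> * (A\<^sup>2 + p))\<^sup>2" by (simp add: power2_eq_square algebra_simps)
      finally have "p * N \<le> \<sigma> * (A\<^sup>2 + p)"
        using 3 s0 by (intro power2_le_imp_le[of "p * N"]) auto
      then have "p \<le> \<sigma> * X" using N by (simp add: X_def field_simps)
      moreover have "v = q * X - p" by (simp add: v X_def)
      ultimately have "(q - \<sigma>) * X \<le> v" by (simp add: algebra_simps)
      moreover have "A\<^sup>2 / (A + \<sigma>) \<le> X"
        unfolding X_def using N 3 by (intro frac_le) auto
      then have "(q - \<sigma>) * (A\<^sup>2 / (A + \<sigma>)) \<le> (q - \<sigma>) * X"
        using \<sigma> by (intro mult_left_mono) auto
      ultimately show ?thesis by simp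
    qed
  qed
  \<comment> \<open>For small \<open>A\<close> the quotient behaves like \<open>A\<^sup>2\<close>,
    for large \<open>A\<close> like \<open>A\<close>; the two regimes are separated at
    \<open>A = 1\<close>.\<close>
  moreover have "min (A\<^sup>2) A / (1 + \<sigma>) \<le> A\<^sup>2 / (A + \<sigma>)"
  proof (cases "A = 0")
    case False
    have "min (A\<^sup>2) A * (A + \<sigma>) \<le> A\<^sup>2 * (1 + \<sigma>)"
    proof (cases "A \<le> 1")
      case True
      then show ?thesis using A0 s0 by (intro mult_mono) auto
    next
      case F: False
      then have "A * \<sigma> * 1 \<le> A * \<sigma> * A" using A0 s0 by (intro mult_left_mono) auto
      then have "A * (A + \<sigma>) \<le> A\<^sup>2 * (1 + \<sigma>)"
        by (simp add: power2_eq_square algebra_simps)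
      then show ?thesis
        using A0 s0 mult_right_mono[of "min (A\<^sup>2) A" A "A + \<sigma>"] by linarith
    qed
    then show ?thesis using A0 s0 False by (simp add: divide_simps)
  qed simp
  then have "(q - \<sigma>) * (min (A\<^sup>2) A / (1 + \<sigma>)) \<le> (q - \<sigma>) * (A\<^sup>2 / (A + \<sigma>))"
    using \<sigma> by (intro mult_left_mono) auto
  moreover have "0 \<le> min (A\<^sup>2) A" using A0 by auto
  then have "min 1 ((q - \<sigma>) / (1 + \<sigma>)) * min (A\<^sup>2) A \<le> 1 * min (A\<^sup>2) A"
    "min 1 ((q - \<sigma>) / (1 + \<sigma>)) * min (A\<^sup>2) A \<le> (q - \<sigma>) / (1 + \<sigma>) * min (A\<^sup>2) A"
    by (intro mult_right_mono; simp)+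
  ultimately have "min 1 ((q - \<sigma>) / (1 + \<sigma>)) * min (A\<^sup>2) A \<le> v"
    by (simp add: min_le_iff_disj) linarith
  then show ?thesis by (simp add: A_def v_def)
qed

lemma borel_measurable_vec_component [measurable (raw)]:
  fixes h :: "'w \<Rightarrow> real ^ 'd"
  assumes "h \<in> borel_measurable M"
  shows "(\<lambda>\<omega>. h \<omega> $ i) \<in> borel_measurable M"
  using assms by (rule measurable_compose) (intro borel_measurable_continuous_onI continuous_intros)

lemma norm_clip_le:
  assumes "0 \<le> q"
  shows "norm (clip q v) \<le> q"
  using assms by (cases "v = 0") (auto simp: clip_def min_def field_simps)

lemma borel_measurable_clip [measurable]: "clip q \<in> borel_measurable borel"
  unfolding clip_def[abs_def] by measurable

section \<open>Square-integrable martingales\<close>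

text \<open>The partial sum frozen once its modulus has reached \<open>\<epsilon>\<close>. The
  recursion replaces a stopping time: whether \<open>X n\<close> is added is decided by the earlier
  terms alone, so the factor of \<open>X n\<close> is predictable.\<close>

primrec stopped_sum :: "real \<Rightarrow> (nat \<Rightarrow> 'a \<Rightarrow> real) \<Rightarrow> nat \<Rightarrow> 'a \<Rightarrow> real" where
  "stopped_sum \<epsilon> X 0 \<omega> = 0"
| "stopped_sum \<epsilon> X (Suc n) \<omega> =
     stopped_sum \<epsilon> X n \<omega> + (if \<bar>stopped_sum \<epsilon> X n \<omega>\<bar> < \<epsilon> then X n \<omega> else 0)"

lemma stopped_sum_eq_sum:
  "(\<And>k. k < n \<Longrightarrow> \<bar>\<Sum>i<k. X i \<omega>\<bar> < \<epsilon>) \<Longrightarrow> stopped_sum \<epsilon> X n \<omega> = (\<Sum>i<n. X i \<omega>)"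
  by (induction n) auto

text \<open>Up to the first index where the level is reached the stopped sum is the ordinary one;
  from there on it no longer moves.\<close>

lemma stopped_sum_ge:
  assumes "k \<le> n" "\<epsilon> \<le> \<bar>\<Sum>i<k. X i \<omega>\<bar>"
  shows "\<epsilon> \<le> \<bar>stopped_sum \<epsilon> X n \<omega>\<bar>"
proof -
  define l where "l = (LEAST k. \<epsilon> \<le> \<bar>\<Sum>i<k. X i \<omega>\<bar>)"
  have l: "\<epsilon> \<le> \<bar>\<Sum>i<l. X i \<omega>\<bar>" unfolding l_def by (rule LeastI) fact
  have "l \<le> k" unfolding l_def by (rule Least_le) fact
  then have "l \<le> n" using assms(1) by simp
  have "\<epsilon> \<le> \<bar>stopped_sum \<epsilon> X (l + j) \<omega>\<bar>" for j
  proof (induction j)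
    case 0
    have "stopped_sum \<epsilon> X l \<omega> = (\<Sum>i<l. X i \<omega>)"
      unfolding l_def by (intro stopped_sum_eq_sum) (auto dest: not_less_Least)
    then show ?case using l by simp
  qed auto
  from this[of "n - l"] show ?thesis using \<open>l \<le> n\<close> by simp
qed

context prob_space
begin

text \<open>Kolmogorov's argument: the cross terms vanish because the sum stopped at level \<open>\<epsilon>\<close> is
  bounded by \<open>\<epsilon>\<close> as long as it still moves.\<close>

lemma martingale_maximal_inequality:
  fixes X :: "nat \<Rightarrow> 'a \<Rightarrow> real"
  assumes F: "\<And>n. subalgebra M (F n)" "\<And>n. subalgebra (F (Suc n)) (F n)"
    and X: "\<And>n. X n \<in> borel_measurable (F (Suc n))"
    and sq: "\<And>n. integrable M (\<lambda>\<omega>. (X n \<omega>)\<^sup>2)"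
    and orth: "\<And>n \<phi> B. \<phi> \<in> borel_measurable (F n) \<Longrightarrow> (\<And>\<omega>. \<bar>\<phi> \<omega>\<bar> \<le> B) \<Longrightarrow>
      (\<integral>\<omega>. \<phi> \<omega> * X n \<omega> \<partial>M) = 0"
    and \<epsilon>: "0 < \<epsilon>"
  shows "prob {\<omega> \<in> space M. \<exists>k\<le>n. \<epsilon> \<le> \<bar>\<Sum>i<k. X i \<omega>\<bar>} \<le> (\<Sum>i<n. \<integral>\<omega>. (X i \<omega>)\<^sup>2 \<partial>M) / \<epsilon>\<^sup>2"
proof -
  let ?T = "stopped_sum \<epsilon> X"
  have XM [measurable]: "X n \<in> borel_measurable M" for n
    by (rule measurable_from_subalg[OF F(1) X])
  have XI: "integrable M (X n)" for n
    by (rule square_integrable_imp_integrable[OF XM sq])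
  have TF: "?T n \<in> borel_measurable (F n)" for n
  proof (induction n)
    case (Suc n)
    have [measurable]: "?T n \<in> borel_measurable (F (Suc n))"
      by (rule measurable_from_subalg[OF F(2) Suc])
    note [measurable] = X[of n]
    show ?case by simp
  qed simp
  have TM [measurable]: "?T n \<in> borel_measurable M" for n
    by (rule measurable_from_subalg[OF F(1) TF])
  have T: "integrable M (\<lambda>\<omega>. (?T n \<omega>)\<^sup>2) \<and> (\<integral>\<omega>. (?T n \<omega>)\<^sup>2 \<partial>M) \<le> (\<Sum>i<n. \<integral>\<omega>. (X i \<omega>)\<^sup>2 \<partial>M)" for n
  proof (induction n)
    case (Suc n)
    define \<phi> where "\<phi> \<omega> = (if \<bar>?T n \<omega>\<bar> < \<epsilon> then ?T n \<omega> else 0)" for \<omega>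
    define Y where "Y \<omega> = (if \<bar>?T n \<omega>\<bar> < \<epsilon> then (X n \<omega>)\<^sup>2 else 0)" for \<omega>
    note [measurable] = TF[of n]
    have \<phi>F: "\<phi> \<in> borel_measurable (F n)" unfolding \<phi>_def[abs_def] by measurable
    have \<phi>B: "\<bar>\<phi> \<omega>\<bar> \<le> \<epsilon>" for \<omega> using \<epsilon> by (simp add: \<phi>_def)
    have [measurable]: "\<phi> \<in> borel_measurable M" by (rule measurable_from_subalg[OF F(1) \<phi>F])
    have i1: "integrable M (\<lambda>\<omega>. \<phi> \<omega> * X n \<omega>)"
      by (rule Bochner_Integration.integrable_bound[where f = "\<lambda>\<omega>. \<epsilon> * X n \<omega>"])
        (use XI \<phi>B \<epsilon> in \<open>auto simp: abs_mult intro!: mult_right_mono\<close>)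
    have i2: "integrable M Y"
      by (rule Bochner_Integration.integrable_bound[OF sq[of n]]) (auto simp: Y_def[abs_def])
    have eq: "(?T (Suc n) \<omega>)\<^sup>2 = (?T n \<omega>)\<^sup>2 + 2 * (\<phi> \<omega> * X n \<omega>) + Y \<omega>" for \<omega>
      by (simp add: \<phi>_def Y_def power2_eq_square algebra_simps)
    have "(\<integral>\<omega>. (?T (Suc n) \<omega>)\<^sup>2 \<partial>M) = (\<integral>\<omega>. (?T n \<omega>)\<^sup>2 \<partial>M) + 2 * (\<integral>\<omega>. \<phi> \<omega> * X n \<omega> \<partial>M) + (\<integral>\<omega>. Y \<omega> \<partial>M)"
      unfolding eq using Suc i1 i2 by simp
    also have "\<dots> = (\<integral>\<omega>. (?T n \<omega>)\<^sup>2 \<partial>M) + (\<integral>\<omega>. Y \<omega> \<partial>M)"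
      using orth[OF \<phi>F \<phi>B] by simp
    also have "(\<integral>\<omega>. Y \<omega> \<partial>M) \<le> (\<integral>\<omega>. (X n \<omega>)\<^sup>2 \<partial>M)"
      by (rule integral_mono[OF i2 sq]) (simp add: Y_def)
    finally have "(\<integral>\<omega>. (?T (Suc n) \<omega>)\<^sup>2 \<partial>M) \<le> (\<Sum>i<Suc n. \<integral>\<omega>. (X i \<omega>)\<^sup>2 \<partial>M)"
      using Suc by simp
    moreover have "integrable M (\<lambda>\<omega>. (?T (Suc n) \<omega>)\<^sup>2)"
      unfolding eq using Suc i1 i2 by simp
    ultimately show ?case by blast
  qed simp
  \<comment> \<open>Freezing turns the event about all \<open>k \<le> n\<close> into one about time
    \<open>n\<close> only, to which Markov's inequality for the square applies.\<close>
  have "prob {\<omega> \<in> space M. \<exists>k\<le>n. \<epsilon> \<le> \<bar>\<Sum>i<k. X i \<omega>\<bar>} \<le> prob {\<omega> \<in> space M. \<epsilon>\<^sup>2 \<le> (?T n \<omega>)\<^sup>2}"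
    using \<epsilon> by (intro finite_measure_mono) (auto simp: abs_le_square_iff[symmetric] intro: stopped_sum_ge)
  also have "\<dots> \<le> (\<integral>\<omega>. (?T n \<omega>)\<^sup>2 \<partial>M) / \<epsilon>\<^sup>2"
    using T[of n] \<epsilon> by (intro integral_Markov_inequality_measure[where A = "{}"]) auto
  also have "\<dots> \<le> (\<Sum>i<n. \<integral>\<omega>. (X i \<omega>)\<^sup>2 \<partial>M) / \<epsilon>\<^sup>2"
    using T[of n] by (intro divide_right_mono) auto
  finally show ?thesis .
qed

text \<open>The maximal inequality, applied to the series restarted at \<open>m\<close>, bounds the
  chance of a later deviation by \<open>\<epsilon>\<close> by a tail of the variance series. As the
  tails vanish, almost every path has for each \<open>\<epsilon>\<close> a starting index without
  such deviation, and is therefore Cauchy.\<close>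

lemma martingale_series_convergent:
  fixes X :: "nat \<Rightarrow> 'a \<Rightarrow> real"
  assumes F: "\<And>n. subalgebra M (F n)" "\<And>n. subalgebra (F (Suc n)) (F n)"
    and X: "\<And>n. X n \<in> borel_measurable (F (Suc n))"
    and sq: "\<And>n. integrable M (\<lambda>\<omega>. (X n \<omega>)\<^sup>2)"
    and orth: "\<And>n \<phi> B. \<phi> \<in> borel_measurable (F n) \<Longrightarrow> (\<And>\<omega>. \<bar>\<phi> \<omega>\<bar> \<le> B) \<Longrightarrow>
      (\<integral>\<omega>. \<phi> \<omega> * X n \<omega> \<partial>M) = 0"
    and summable: "summable (\<lambda>n. \<integral>\<omega>. (X n \<omega>)\<^sup>2 \<partial>M)"
  shows "AE \<omega> in M. convergent (\<lambda>n. \<Sum>i<n. X i \<omega>)"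
proof -
  have [measurable]: "X n \<in> borel_measurable M" for n
    by (rule measurable_from_subalg[OF F(1) X])
  define v where "v n = (\<integral>\<omega>. (X n \<omega>)\<^sup>2 \<partial>M)" for n
  have v0: "0 \<le> v n" for n by (simp add: v_def)
  define Y where "Y \<epsilon> m = {\<omega> \<in> space M. \<exists>k. \<epsilon> \<le> \<bar>\<Sum>i<k. X (m + i) \<omega>\<bar>}" for \<epsilon> :: real and m
  have Y [measurable]: "Y \<epsilon> m \<in> events" for \<epsilon> m unfolding Y_def by measurable
  have prob_Y: "prob (Y \<epsilon> m) \<le> (\<Sum>i. v (i + m)) / \<epsilon>\<^sup>2" if \<epsilon>: "0 < \<epsilon>" for \<epsilon> m
  proof -
    \<comment> \<open>The maximal inequality has a finite horizon; the events \<open>Z n\<close>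
      increase to \<open>Y \<epsilon> m\<close>, so the uniform bound passes to the limit.\<close>
    define Z where "Z n = {\<omega> \<in> space M. \<exists>k\<le>n. \<epsilon> \<le> \<bar>\<Sum>i<k. X (m + i) \<omega>\<bar>}" for n
    have Z [measurable]: "Z n \<in> events" for n unfolding Z_def by measurable
    have "incseq Z" unfolding incseq_def Z_def by (auto intro: order_trans)
    moreover have "(\<Union>n. Z n) = Y \<epsilon> m" unfolding Y_def Z_def by auto
    ultimately have "(\<lambda>n. prob (Z n)) \<longlonglongrightarrow> prob (Y \<epsilon> m)"
      using finite_Lim_measure_incseq[of Z] Z by (metis image_subsetI)
    moreover have "prob (Z n) \<le> (\<Sum>i. v (i + m)) / \<epsilon>\<^sup>2" for n
    proof -
      have "prob (Z n) \<le> (\<Sum>i<n. v (m + i)) / \<epsilon>\<^sup>2"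
        unfolding Z_def v_def
      proof (rule martingale_maximal_inequality[where F = "\<lambda>n. F (m + n)"])
        fix n and \<phi> :: "'a \<Rightarrow> real" and B
        assume "\<phi> \<in> borel_measurable (F (m + n))" "\<And>\<omega>. \<bar>\<phi> \<omega>\<bar> \<le> B"
        then show "(\<integral>\<omega>. \<phi> \<omega> * X (m + n) \<omega> \<partial>M) = 0" by (rule orth)
      qed (use F X sq \<epsilon> in auto)
      also have "\<dots> \<le> (\<Sum>i. v (i + m)) / \<epsilon>\<^sup>2"
        using summable v0
        by (auto simp: v_def[symmetric] add.commute[of m]
            intro!: divide_right_mono sum_le_suminf summable_ignore_initial_segment)
      finally show ?thesis .
    qed
    ultimately show ?thesis by (intro LIMSEQ_le_const2) auto
  qed
  have null: "AE \<omega> in M. \<exists>m. \<omega> \<notin> Y \<epsilon> m" if \<epsilon>: "0 < \<epsilon>" for \<epsilon>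
  proof -
    have "prob (\<Inter>m. Y \<epsilon> m) \<le> 0 + e" if e: "0 < e" for e
    proof -
      obtain m where m: "norm (\<Sum>i. v (i + m)) < e * \<epsilon>\<^sup>2"
        using suminf_exist_split[OF _ summable[folded v_def], of "e * \<epsilon>\<^sup>2"] e \<epsilon> by auto
      have "prob (\<Inter>m. Y \<epsilon> m) \<le> prob (Y \<epsilon> m)" by (intro finite_measure_mono) auto
      also have "\<dots> \<le> (\<Sum>i. v (i + m)) / \<epsilon>\<^sup>2" by (rule prob_Y) fact
      also have "\<dots> \<le> e" using m \<epsilon> by (simp add: divide_simps)
      finally show ?thesis by simp
    qed
    then have "prob (\<Inter>m. Y \<epsilon> m) \<le> 0" by (rule field_le_epsilon)
    then have "prob (\<Inter>m. Y \<epsilon> m) = 0" by (simp add: measure_le_0_iff)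
    then have "AE \<omega> in M. \<omega> \<notin> (\<Inter>m. Y \<epsilon> m)"
      by (subst (asm) prob_eq_0) auto
    then show ?thesis by simp
  qed
  \<comment> \<open>The thresholds \<open>1 / (j + 1)\<close> suffice for the Cauchy property and
    are countable, so one null set serves all of them.\<close>
  have "AE \<omega> in M. \<forall>j. \<exists>m. \<omega> \<notin> Y (1 / real (Suc j)) m"
    by (subst AE_all_countable) (auto intro!: null simp del: of_nat_Suc)
  then show ?thesis
  proof (rule AE_mp, intro AE_I2 impI)
    fix \<omega> assume \<omega>: "\<omega> \<in> space M" and *: "\<forall>j. \<exists>m. \<omega> \<notin> Y (1 / real (Suc j)) m"
    have "Cauchy (\<lambda>n. \<Sum>i<n. X i \<omega>)"
    proof (rule metric_CauchyI)
      fix e :: real assume "0 < e"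
      then obtain j where j: "1 / real (Suc j) < e / 2"
        using nat_approx_posE[of "e / 2"] by auto
      from * obtain m where m: "\<omega> \<notin> Y (1 / real (Suc j)) m" by blast
      have close: "dist (\<Sum>i<n. X i \<omega>) (\<Sum>i<m. X i \<omega>) < e / 2" if "m \<le> n" for n
      proof -
        have "(\<Sum>i<m + k. X i \<omega>) = (\<Sum>i<m. X i \<omega>) + (\<Sum>i<k. X (m + i) \<omega>)" for k
          by (induction k) simp_all
        from this[of "n - m"] have "(\<Sum>i<n. X i \<omega>) = (\<Sum>i<m. X i \<omega>) + (\<Sum>i<n - m. X (m + i) \<omega>)"
          using that by simp
        moreover have "\<bar>\<Sum>i<n - m. X (m + i) \<omega>\<bar> < 1 / real (Suc j)"
          using m \<omega> by (simp add: Y_def not_le del: of_nat_Suc)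
        ultimately show ?thesis using j by (simp add: dist_real_def)
      qed
      then show "\<exists>N. \<forall>n\<ge>N. \<forall>k\<ge>N. dist (\<Sum>i<n. X i \<omega>) (\<Sum>i<k. X i \<omega>) < e"
        using dist_triangle_half_l by blast
    qed
    then show "convergent (\<lambda>n. \<Sum>i<n. X i \<omega>)" by (rule Cauchy_convergent)
  qed
qed
end

section \<open>A deterministic convergence criterion\<close>

text \<open>\<open>A\<close> must return below each level, since otherwise \<open>\<alpha>\<close>
  would be summable. During an excursion above \<open>\<epsilon>\<close> the weights are bounded
  below, so a small tail of the weighted series leaves little total step length; by
  \<open>osc\<close> the excursion then cannot climb far.\<close>

lemma tendsto_0_of_weighted_sum:
  fixes A \<alpha> :: "nat \<Rightarrow> real" and e :: "nat \<Rightarrow> 'a::real_normed_vector"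
  assumes A: "\<And>n. 0 \<le> A n" and \<alpha>: "\<And>n. 0 \<le> \<alpha> n" and C: "0 \<le> C"
    and \<alpha>0: "\<alpha> \<longlonglongrightarrow> 0" and div: "\<not> summable \<alpha>"
    and sm: "summable (\<lambda>n. \<alpha> n * min ((A n)\<^sup>2) (A n))"
    and e: "Cauchy e"
    and osc: "\<And>k n. k \<le> n \<Longrightarrow> A n - A k \<le> C * (\<Sum>t=k..<n. \<alpha> t) + norm (e n - e k)"
  shows "A \<longlonglongrightarrow> 0"
proof (rule LIMSEQ_I)
  fix r :: real assume "0 < r"
  \<comment> \<open>The four shares of \<open>r\<close>: one for the value where the excursion
    starts, two for the step length times \<open>C\<close>, one for the oscillation of
    \<open>e\<close>.\<close>
  define \<epsilon> where "\<epsilon> = r / 4"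
  have \<epsilon>: "0 < \<epsilon>" using \<open>0 < r\<close> by (simp add: \<epsilon>_def)
  define d where "d = min (\<epsilon>\<^sup>2) \<epsilon>"
  have d: "0 < d" using \<epsilon> by (simp add: d_def)
  have d_le: "d \<le> min ((A n)\<^sup>2) (A n)" if "\<epsilon> \<le> A n" for n
    using that \<epsilon> power_mono[OF that, of 2] by (auto simp: d_def min.coboundedI1)
  obtain N1 where N1: "\<And>n k. N1 \<le> n \<Longrightarrow> N1 \<le> k \<Longrightarrow> norm (e n - e k) < \<epsilon>"
    using CauchyD[OF e \<epsilon>] by blast
  \<comment> \<open>Dividing by \<open>C + 1\<close> keeps the quotient defined when
    \<open>C = 0\<close>.\<close>
  have "0 < \<epsilon> / (C + 1)" using \<epsilon> C by simp
  from LIMSEQ_D[OF \<alpha>0 this] obtain N2 where N2: "\<And>n. N2 \<le> n \<Longrightarrow> \<bar>\<alpha> n\<bar> < \<epsilon> / (C + 1)"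
    by auto
  have "0 < d * \<epsilon> / (C + 1)" using \<epsilon> C d by simp
  with sm[unfolded summable_Cauchy]
  obtain N3 where "\<forall>k\<ge>N3. \<forall>n. norm (\<Sum>t=k..<n. \<alpha> t * min ((A t)\<^sup>2) (A t)) < d * \<epsilon> / (C + 1)"
    by blast
  then have N3: "(\<Sum>t=k..<n. \<alpha> t * min ((A t)\<^sup>2) (A t)) < d * \<epsilon> / (C + 1)" if "N3 \<le> k" for k n
    using that by (auto simp: abs_less_iff)
  define N where "N = max N1 (max N2 N3)"
  have "\<exists>n0\<ge>N. A n0 < \<epsilon>"
  proof (rule ccontr)
    assume "\<not> ?thesis"
    then have *: "\<epsilon> \<le> A n" if "N \<le> n" for n using that by (auto simp: not_less)
    have "summable \<alpha>"
    proof (rule summable_comparison_test)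
      show "\<exists>N. \<forall>n\<ge>N. norm (\<alpha> n) \<le> \<alpha> n * min ((A n)\<^sup>2) (A n) / d"
      proof (intro exI[of _ N] allI impI)
        fix n assume "N \<le> n"
        then show "norm (\<alpha> n) \<le> \<alpha> n * min ((A n)\<^sup>2) (A n) / d"
          using mult_left_mono[OF d_le[OF *] \<alpha>, of n n] d \<alpha>[of n] by (simp add: field_simps)
      qed
      show "summable (\<lambda>n. \<alpha> n * min ((A n)\<^sup>2) (A n) / d)" using sm by (rule summable_divide)
    qed
    with div show False ..
  qed
  then obtain n0 where n0: "N \<le> n0" "A n0 < \<epsilon>" by blast
  \<comment> \<open>The last time up to \<open>n\<close> at which \<open>A\<close> is below
    \<open>\<epsilon>\<close>; after it, \<open>d_le\<close> bounds the weights from below.\<close>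
  have last_small: "\<exists>m. n0 \<le> m \<and> m \<le> n \<and> A m < \<epsilon> \<and> (\<forall>t. m < t \<and> t \<le> n \<longrightarrow> \<epsilon> \<le> A t)" if "n0 \<le> n" for n
    using that
  proof (induction n rule: dec_induct)
    case base
    then show ?case using n0 by auto
  next
    case (step n)
    show ?case
    proof (cases "A (Suc n) < \<epsilon>")
      case True
      then show ?thesis using step by (intro exI[of _ "Suc n"]) auto
    next
      case False
      with step obtain m where "n0 \<le> m \<and> m \<le> n \<and> A m < \<epsilon> \<and> (\<forall>t. m < t \<and> t \<le> n \<longrightarrow> \<epsilon> \<le> A t)"
        by blast
      then show ?thesis using False by (intro exI[of _ m]) (auto simp: le_Suc_eq)
    qed
  qed
  have "A n < r" if n: "n0 \<le> n" for n
  proof -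
    obtain m where m: "n0 \<le> m" "m \<le> n" "A m < \<epsilon>" "\<And>t. m < t \<Longrightarrow> t \<le> n \<Longrightarrow> \<epsilon> \<le> A t"
      using last_small[OF n] by blast
    have Nm: "N1 \<le> m" "N2 \<le> m" "N3 \<le> Suc m" "N1 \<le> n" using m n0 by (auto simp: N_def)
    show ?thesis
    proof (cases "m = n")
      case False
      \<comment> \<open>At \<open>m\<close> itself \<open>A\<close> is below
        \<open>\<epsilon>\<close>, so the weighted series says nothing about
        \<open>\<alpha> m\<close>; this single step is small because \<open>\<alpha>\<close> tends
        to 0.\<close>
      then have split: "(\<Sum>t=m..<n. \<alpha> t) = \<alpha> m + (\<Sum>t=Suc m..<n. \<alpha> t)"
        using m by (subst sum.atLeast_Suc_lessThan) auto
      have "d * (\<Sum>t=Suc m..<n. \<alpha> t) \<le> (\<Sum>t=Suc m..<n. \<alpha> t * min ((A t)\<^sup>2) (A t))"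
        unfolding sum_distrib_left
      proof (rule sum_mono)
        fix t assume "t \<in> {Suc m..<n}"
        then show "d * \<alpha> t \<le> \<alpha> t * min ((A t)\<^sup>2) (A t)"
          using mult_left_mono[OF d_le[OF m(4)] \<alpha>, of t t] by (simp add: mult.commute)
      qed
      also have "\<dots> < d * (\<epsilon> / (C + 1))" using N3[OF Nm(3)] by simp
      finally have "(\<Sum>t=Suc m..<n. \<alpha> t) < \<epsilon> / (C + 1)"
        using d by (simp only: mult_less_cancel_left_pos)
      then have "(\<Sum>t=m..<n. \<alpha> t) \<le> 2 * (\<epsilon> / (C + 1))"
        unfolding split using N2[OF Nm(2)] by simp
      then have "C * (\<Sum>t=m..<n. \<alpha> t) \<le> C * (2 * (\<epsilon> / (C + 1)))" using C by (rule mult_left_mono)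
      also have "\<dots> \<le> 2 * \<epsilon>" using C \<epsilon> by (simp add: field_simps)
      finally show ?thesis
        using osc[OF m(2)] m(3) N1[OF Nm(4) Nm(1)] by (simp add: \<epsilon>_def)
    qed (use m \<epsilon> in \<open>auto simp: \<epsilon>_def\<close>)
  qed
  then show "\<exists>no. \<forall>n\<ge>no. norm (A n - 0) < r" using A by (intro exI[of _ n0]) auto
qed

section \<open>Descent with momentum\<close>

lemma borel_measurable_if_lipschitz:
  fixes h :: "'a::euclidean_space \<Rightarrow> 'b::euclidean_space"
  assumes "\<And>z w. norm (h z - h w) \<le> L * norm (z - w)"
  shows "h \<in> borel_measurable borel"
proof (rule borel_measurable_continuous_onI)
  have "norm (h z - h w) \<le> max L 0 * norm (z - w)" for z w
    using assms[of z w] mult_right_mono[of L "max L 0" "norm (z - w)"] by simp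
  then have "(max L 0)-lipschitz_on UNIV h" by (intro lipschitz_onI) (auto simp: dist_norm)
  then show "continuous_on UNIV h" by (rule lipschitz_on_continuous_on)
qed

text \<open>The mean value theorem on the segment, with the Lipschitz bound at the intermediate
  point. This gives the constant \<open>L\<close> in place of the sharp \<open>L / 2\<close>, at no
  loss for what follows.\<close>

lemma gradient_descent_bound:
  fixes f :: "'a::euclidean_space \<Rightarrow> real"
  assumes gradient: "\<And>z. GDERIV f z :> grad_f z"
    and lipschitz: "\<And>z w. norm (grad_f z - grad_f w) \<le> L * norm (z - w)" and L: "0 \<le> L"
  shows "f (z + h) \<le> f z + inner (grad_f z) h + L * (norm h)\<^sup>2"
proof -
  have der: "((\<lambda>t. f (z + t *\<^sub>R h)) has_real_derivative inner h (grad_f (z + t *\<^sub>R h))) (at t)" for t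
  proof -
    have "(f has_derivative (\<lambda>k. inner k (grad_f (z + t *\<^sub>R h)))) (at (z + t *\<^sub>R h))"
      using gradient by (simp add: gderiv_def)
    then have "((\<lambda>t. f (z + t *\<^sub>R h)) has_derivative (\<lambda>s. inner (s *\<^sub>R h) (grad_f (z + t *\<^sub>R h)))) (at t)"
      by (rule has_derivative_compose[rotated]) (auto intro!: derivative_eq_intros)
    then show ?thesis by (simp add: has_field_derivative_def mult_commute_abs)
  qed
  obtain t where t: "0 < t" "t < 1"
    and eq: "f (z + 1 *\<^sub>R h) - f (z + 0 *\<^sub>R h) = (1 - 0) * inner h (grad_f (z + t *\<^sub>R h))"
    using MVT2[of 0 1 "\<lambda>t. f (z + t *\<^sub>R h)", OF _ der] by auto
  have "inner h (grad_f (z + t *\<^sub>R h) - grad_f z) \<le> norm h * norm (grad_f (z + t *\<^sub>R h) - grad_f z)"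
    by (rule norm_cauchy_schwarz)
  also have "\<dots> \<le> norm h * (L * norm (t *\<^sub>R h))"
    using lipschitz[of "z + t *\<^sub>R h" z] by (intro mult_left_mono) auto
  also have "\<dots> \<le> norm h * (L * norm h)"
    using t L by (intro mult_left_mono) (auto simp: mult_left_le_one_le)
  finally show ?thesis
    using eq by (simp add: inner_diff_right power2_eq_square algebra_simps inner_commute)
qed

text \<open>The step \<open>- 1 / (2 * L)\<close> along the gradient minimizes the quadratic upper
  bound and lowers it by a quarter of the squared gradient norm over \<open>L\<close>, yet
  \<open>f\<close> cannot fall below \<open>f_star\<close>.\<close>

lemma norm_gradient_square_le:
  fixes f :: "'a::euclidean_space \<Rightarrow> real"
  assumes gradient: "\<And>z. GDERIV f z :> grad_f z"
    and lipschitz: "\<And>z w. norm (grad_f z - grad_f w) \<le> L * norm (z - w)" and L: "0 < L"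
    and below: "\<And>z. f_star \<le> f z"
  shows "(norm (grad_f z))\<^sup>2 \<le> 4 * L * (f z - f_star)"
proof -
  let ?h = "(- 1 / (2 * L)) *\<^sub>R grad_f z"
  have "f_star \<le> f (z + ?h)" by (rule below)
  also have "\<dots> \<le> f z + inner (grad_f z) ?h + L * (norm ?h)\<^sup>2"
    using L by (intro gradient_descent_bound gradient lipschitz) auto
  also have "\<dots> = f z - (norm (grad_f z))\<^sup>2 / (4 * L)"
    using L by (simp add: power2_norm_eq_inner[symmetric] power_mult_distrib power_divide
        field_simps) (simp add: power2_eq_square)
  finally show ?thesis using L by (simp add: field_simps)
qed

text \<open>Convexity of the square: the vector is the combination of \<open>u\<close> and
  \<open>- v / (1 - \<beta>)\<close> with weights \<open>\<beta>\<close> and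
  \<open>1 - \<beta>\<close>. The proof writes the convexity gap for the norms as a square.\<close>

lemma norm_square_convex_step:
  fixes u v :: "'a::real_normed_vector"
  assumes "0 \<le> \<beta>" "\<beta> < 1"
  shows "(norm (\<beta> *\<^sub>R u - v))\<^sup>2 \<le> \<beta> * (norm u)\<^sup>2 + (norm v)\<^sup>2 / (1 - \<beta>)"
proof -
  define a b where "a = norm u" and "b = norm v"
  have "norm (\<beta> *\<^sub>R u - v) \<le> \<beta> * a + b"
    using norm_triangle_ineq4[of "\<beta> *\<^sub>R u" v] assms by (simp add: a_def b_def)
  then have "(norm (\<beta> *\<^sub>R u - v))\<^sup>2 \<le> (\<beta> * a + b)\<^sup>2" by (intro power_mono) auto
  also have "\<dots> = \<beta> * a\<^sup>2 + b\<^sup>2 / (1 - \<beta>) - \<beta> * ((1 - \<beta>) * a - b)\<^sup>2 / (1 - \<beta>)"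
  proof -
    have "(\<beta> * a + b)\<^sup>2 * (1 - \<beta>) = \<beta> * a\<^sup>2 * (1 - \<beta>) + b\<^sup>2 - \<beta> * ((1 - \<beta>) * a - b)\<^sup>2"
      by (simp add: power2_eq_square algebra_simps)
    then have "(\<beta> * a + b)\<^sup>2 = (\<beta> * a\<^sup>2 * (1 - \<beta>) + b\<^sup>2 - \<beta> * ((1 - \<beta>) * a - b)\<^sup>2) / (1 - \<beta>)"
      using assms by (simp add: nonzero_eq_divide_eq)
    then show ?thesis using assms by (simp add: add_divide_distrib diff_divide_distrib)
  qed
  also have "\<dots> \<le> \<beta> * a\<^sup>2 + b\<^sup>2 / (1 - \<beta>)" using assms by simp
  finally show ?thesis by (simp add: a_def b_def)
qed

text \<open>The weight of \<open>(norm m)\<^sup>2\<close> in the Lyapunov function absorbs the error made by evaluating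
  the gradient at \<open>x\<close> instead of \<open>z\<close>.\<close>

lemma momentum_lyapunov_step:
  fixes f :: "'a::euclidean_space \<Rightarrow> real"
  assumes gradient: "\<And>z. GDERIV f z :> grad_f z"
    and lipschitz: "\<And>z w. norm (grad_f z - grad_f w) \<le> L * norm (z - w)" and L: "0 \<le> L"
    and \<beta>: "0 \<le> \<beta>" "\<beta> < 1" and c: "0 \<le> c" "0 \<le> c'" and \<alpha>: "0 \<le> \<alpha>" and B: "norm b \<le> B"
    and b: "\<psi> \<le> inner (grad_f x) b" and x: "x = z - c' *\<^sub>R m"
  defines "K \<equiv> c * L * c' * B / 2"
  defines "\<Lambda> \<equiv> K / (1 - \<beta>)"
  shows "f (z - (c * \<alpha>) *\<^sub>R (b + d)) + \<Lambda> * (norm (\<beta> *\<^sub>R m - \<alpha> *\<^sub>R (b + d)))\<^sup>2 + c * \<alpha> * \<psi>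
    \<le> f z + \<Lambda> * (norm m)\<^sup>2 - c * \<alpha> * inner (grad_f z) d
      + (K + (L * c\<^sup>2 + \<Lambda> / (1 - \<beta>)) * (norm (b + d))\<^sup>2) * \<alpha>\<^sup>2"
proof -
  have B0: "0 \<le> B" using B norm_ge_zero order_trans by blast
  then have K: "0 \<le> K" using c L by (simp add: K_def)
  then have \<Lambda>: "0 \<le> \<Lambda>" using \<beta> by (simp add: \<Lambda>_def)
  have "f (z - (c * \<alpha>) *\<^sub>R (b + d))
      \<le> f z + inner (grad_f z) (- ((c * \<alpha>) *\<^sub>R (b + d))) + L * (norm (- ((c * \<alpha>) *\<^sub>R (b + d))))\<^sup>2"
    using gradient_descent_bound[OF gradient lipschitz L, of z "- ((c * \<alpha>) *\<^sub>R (b + d))"] by simp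
  also have "\<dots> = f z - c * \<alpha> * inner (grad_f z) b - c * \<alpha> * inner (grad_f z) d
      + L * c\<^sup>2 * (norm (b + d))\<^sup>2 * \<alpha>\<^sup>2"
    unfolding norm_minus_cancel inner_minus_right norm_scaleR power_mult_distrib
    by (simp add: inner_add_right power_mult_distrib algebra_simps)
  finally have 1: "f (z - (c * \<alpha>) *\<^sub>R (b + d)) \<le> \<dots>" .
  \<comment> \<open>Descent is known for the gradient at \<open>x\<close>, but the expansion of
    \<open>f\<close> is at \<open>z\<close>. Their distance is \<open>c' * norm m\<close>, so the
    exchange costs at most \<open>L * c' * B * norm m\<close>.\<close>
  have "inner (grad_f x - grad_f z) b \<le> norm (grad_f x - grad_f z) * norm b"
    by (rule norm_cauchy_schwarz)
  also have "\<dots> \<le> (L * (c' * norm m)) * B"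
    using lipschitz[of x z] B c L by (intro mult_mono) (auto simp: x)
  finally have "\<psi> - L * c' * B * norm m \<le> inner (grad_f z) b"
    using b by (simp add: inner_diff_left algebra_simps)
  then have "c * \<alpha> * (\<psi> - L * c' * B * norm m) \<le> c * \<alpha> * inner (grad_f z) b"
    using c \<alpha> by (intro mult_left_mono) auto
  then have 2: "c * \<alpha> * \<psi> \<le> c * \<alpha> * inner (grad_f z) b + K * (2 * (\<alpha> * norm m))"
    by (simp add: K_def algebra_simps)
  \<comment> \<open>Young's inequality turns the mixed cost into a summable part in
    \<open>\<alpha>\<^sup>2\<close> and a part in \<open>(norm m)\<^sup>2\<close>; the 2 in the
    denominator of \<open>K\<close> anticipates it.\<close>
  have "2 * (\<alpha> * norm m) \<le> \<alpha>\<^sup>2 + (norm m)\<^sup>2"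
    using sum_squares_bound[of \<alpha> "norm m"] by (simp add: mult.assoc)
  then have 3: "K * (2 * (\<alpha> * norm m)) \<le> K * \<alpha>\<^sup>2 + K * (norm m)\<^sup>2"
    using mult_left_mono[OF _ K] by (fastforce simp: algebra_simps)
  have "\<Lambda> * (norm (\<beta> *\<^sub>R m - \<alpha> *\<^sub>R (b + d)))\<^sup>2
      \<le> \<Lambda> * (\<beta> * (norm m)\<^sup>2 + (norm (\<alpha> *\<^sub>R (b + d)))\<^sup>2 / (1 - \<beta>))"
    using \<Lambda> by (intro mult_left_mono norm_square_convex_step \<beta>) auto
  also have "\<dots> = \<Lambda> * \<beta> * (norm m)\<^sup>2 + \<Lambda> / (1 - \<beta>) * (norm (b + d))\<^sup>2 * \<alpha>\<^sup>2"
    unfolding norm_scaleR power_mult_distrib by (simp add: algebra_simps)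
  \<comment> \<open>The equation that determines \<open>\<Lambda>\<close>: the geometric decay of
    the momentum term releases exactly \<open>K * (norm m)\<^sup>2\<close>, which pays for the
    exchange of gradients.\<close>
  also have "\<Lambda> * \<beta> = \<Lambda> - K" using \<beta> by (simp add: \<Lambda>_def field_simps)
  finally show ?thesis using 1 2 3 by (simp add: algebra_simps)
qed

text \<open>Summing the recursion bounds a partial sum by \<open>\<beta>\<close> times itself plus a
  constant, and \<open>\<beta> < 1\<close> lets one solve for it.\<close>

lemma summable_contraction:
  fixes u v :: "nat \<Rightarrow> real"
  assumes u: "\<And>n. 0 \<le> u n" and \<beta>: "0 \<le> \<beta>" "\<beta> < 1"
    and step: "\<And>n. u (Suc n) \<le> \<beta> * u n + v n" and v: "\<And>n. 0 \<le> v n" "summable v"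
  shows "summable u"
proof (rule summableI_nonneg_bounded)
  fix n
  have "(\<Sum>t<n. u t) \<le> (\<Sum>t<Suc n. u t)" using u by simp
  also have "\<dots> = u 0 + (\<Sum>t<n. u (Suc t))" by (rule sum.lessThan_Suc_shift)
  also have "(\<Sum>t<n. u (Suc t)) \<le> (\<Sum>t<n. \<beta> * u t + v t)" by (intro sum_mono step)
  also have "\<dots> = \<beta> * (\<Sum>t<n. u t) + (\<Sum>t<n. v t)" by (simp add: sum.distrib sum_distrib_left)
  also have "(\<Sum>t<n. v t) \<le> suminf v" using v by (intro sum_le_suminf) auto
  finally show "(\<Sum>t<n. u t) \<le> (u 0 + suminf v) / (1 - \<beta>)"
    using \<beta> by (simp add: field_simps)
qed (rule u)

text \<open>By monotone convergence the sum has finite expectation, hence is finite almost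
  everywhere.\<close>

lemma AE_summable_of_summable_integral:
  fixes Y :: "nat \<Rightarrow> 'a \<Rightarrow> real"
  assumes Y: "\<And>t \<omega>. 0 \<le> Y t \<omega>" "\<And>t. integrable M (Y t)"
    and s: "summable (\<lambda>t. \<integral>\<omega>. Y t \<omega> \<partial>M)"
  shows "AE \<omega> in M. summable (\<lambda>t. Y t \<omega>)"
proof -
  note [measurable] = borel_measurable_integrable[OF Y(2)]
  have "(\<integral>\<^sup>+\<omega>. (\<Sum>t. ennreal (Y t \<omega>)) \<partial>M) = (\<Sum>t. \<integral>\<^sup>+\<omega>. ennreal (Y t \<omega>) \<partial>M)"
    by (rule nn_integral_suminf) simp
  also have "\<dots> = (\<Sum>t. ennreal (\<integral>\<omega>. Y t \<omega> \<partial>M))"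
    using Y by (simp add: nn_integral_eq_integral)
  also have "\<dots> = ennreal (\<Sum>t. \<integral>\<omega>. Y t \<omega> \<partial>M)"
    using Y s by (intro suminf_ennreal2) auto
  finally have "(\<integral>\<^sup>+\<omega>. (\<Sum>t. ennreal (Y t \<omega>)) \<partial>M) \<noteq> \<infinity>" by simp
  then have "AE \<omega> in M. (\<Sum>t. ennreal (Y t \<omega>)) \<noteq> \<infinity>"
    by (intro nn_integral_PInf_AE) auto
  then show ?thesis
    by eventually_elim (auto intro: summable_suminf_not_top Y)
qed

lemma convergent_vec:
  fixes s :: "nat \<Rightarrow> real ^ 'd"
  assumes "\<And>i. convergent (\<lambda>n. s n $ i)"
  shows "convergent s"
proof -
  have "s \<longlonglongrightarrow> (\<chi> i. lim (\<lambda>n. s n $ i))"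
    using assms by (intro vec_tendstoI) (simp add: convergent_LIMSEQ_iff)
  then show ?thesis by (rule convergentI)
qed

lemma norm_diff_square_le:
  fixes u v :: "'a::real_inner"
  shows "(norm (u - v))\<^sup>2 \<le> 2 * (norm u)\<^sup>2 + 2 * (norm v)\<^sup>2"
  using inner_ge_zero[of "u + v"]
  by (simp add: power2_norm_eq_inner inner_add_left inner_add_right inner_diff_left inner_diff_right
      inner_commute)

section \<open>Almost sure convergence for the common momentum form\<close>

text \<open>A common form of the three methods: \<open>z\<close> performs plain gradient steps, \<open>m\<close> is the
  momentum and \<open>z - c' m\<close> is the point at which the gradient is evaluated. Only \<open>D\<close> is a
  martingale difference; \<open>b\<close> need not be adapted.\<close>

locale noisy_momentum_descent = prob_space M for M :: "'w measure" +
  fixes F :: "nat \<Rightarrow> 'w measure"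
    and f :: "real ^ 'd \<Rightarrow> real" and grad_f :: "real ^ 'd \<Rightarrow> real ^ 'd"
    and f_star L \<beta> c c' B \<kappa> \<rho> :: real and \<alpha> :: "nat \<Rightarrow> real"
    and z m b D :: "nat \<Rightarrow> 'w \<Rightarrow> real ^ 'd"
  assumes F_subalgebra: "\<And>t. subalgebra M (F t)"
    and F_Suc: "\<And>t. subalgebra (F (Suc t)) (F t)"
    and gradient: "\<And>w. GDERIV f w :> grad_f w"
    and lipschitz: "\<And>w w'. norm (grad_f w - grad_f w') \<le> L * norm (w - w')"
    and below: "\<And>w. f_star \<le> f w"
    and pos: "0 < L" "0 \<le> \<beta>" "\<beta> < 1" "0 < c" "0 \<le> c'" "0 < \<kappa>"
    and \<alpha>_pos: "\<And>t. 0 < \<alpha> t"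
    and \<alpha>_square: "summable (\<lambda>t. (\<alpha> t)\<^sup>2)" and \<alpha>_sum: "\<not> summable \<alpha>"
    and z_measurable: "\<And>t. z t \<in> borel_measurable (F t)"
    and m_measurable: "\<And>t. m t \<in> borel_measurable (F t)"
    and D_measurable: "\<And>t. D t \<in> borel_measurable (F (Suc t))"
    and b_measurable: "\<And>t. b t \<in> borel_measurable M"
    and z_Suc: "\<And>t \<omega>. \<omega> \<in> space M \<Longrightarrow> z (Suc t) \<omega> = z t \<omega> - (c * \<alpha> t) *\<^sub>R (b t \<omega> + D t \<omega>)"
    and m_Suc: "\<And>t \<omega>. \<omega> \<in> space M \<Longrightarrow> m (Suc t) \<omega> = \<beta> *\<^sub>R m t \<omega> - \<alpha> t *\<^sub>R (b t \<omega> + D t \<omega>)"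
    and b_bounded: "\<And>t. AE \<omega> in M. norm (b t \<omega>) \<le> B"
    and b_descent: "\<And>t. AE \<omega> in M.
      \<kappa> * min ((norm (grad_f (z t \<omega> - c' *\<^sub>R m t \<omega>)))\<^sup>2) (norm (grad_f (z t \<omega> - c' *\<^sub>R m t \<omega>)))
        \<le> inner (grad_f (z t \<omega> - c' *\<^sub>R m t \<omega>)) (b t \<omega>)"
    and g_square: "\<And>t. integrable M (\<lambda>\<omega>. (norm (b t \<omega> + D t \<omega>))\<^sup>2)"
      "\<And>t. (\<integral>\<omega>. (norm (b t \<omega> + D t \<omega>))\<^sup>2 \<partial>M) \<le> \<rho>"
    and D_orthogonal: "\<And>t \<phi> i. \<phi> \<in> borel_measurable (F t) \<Longrightarrow> integrable M \<phi> \<Longrightarrow>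
      integrable M (\<lambda>\<omega>. \<phi> \<omega> * D t \<omega> $ i) \<and> (\<integral>\<omega>. \<phi> \<omega> * D t \<omega> $ i \<partial>M) = 0"
begin

lemma measurable_M [measurable]:
  "z t \<in> borel_measurable M" "m t \<in> borel_measurable M" "D t \<in> borel_measurable M"
  "b t \<in> borel_measurable M"
  using measurable_from_subalg[OF F_subalgebra] z_measurable m_measurable D_measurable b_measurable
  by blast+

lemma grad_f_measurable [measurable]: "grad_f \<in> borel_measurable borel"
  using lipschitz by (rule borel_measurable_if_lipschitz)

lemma f_measurable [measurable]: "f \<in> borel_measurable borel"
proof (rule borel_measurable_continuous_onI)
  show "continuous_on UNIV f"
    using gradient unfolding gderiv_def
    by (meson has_derivative_continuous continuous_at_imp_continuous_on)
qed

lemma AE_summable_step_square: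
  "AE \<omega> in M. summable (\<lambda>t. (norm (b t \<omega> + D t \<omega>))\<^sup>2 * (\<alpha> t)\<^sup>2)"
proof (rule AE_summable_of_summable_integral)
  show "summable (\<lambda>t. \<integral>\<omega>. (norm (b t \<omega> + D t \<omega>))\<^sup>2 * (\<alpha> t)\<^sup>2 \<partial>M)"
    by (rule summable_comparison_test'[OF summable_mult[OF \<alpha>_square, of \<rho>], of 0])
      (use g_square in \<open>auto simp: abs_mult intro!: mult_right_mono\<close>)
qed (use g_square in auto)

text \<open>\<open>D\<close> is the difference of \<open>b + D\<close>, with second moment at most
  \<open>\<rho>\<close>, and \<open>b\<close>, bounded by \<open>B\<close>. So its second moments
  are uniformly bounded, and square summable steps make each coordinate an
  \<open>L\<^sup>2\<close>-bounded martingale.\<close>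

lemma AE_noise_series_convergent: "AE \<omega> in M. convergent (\<lambda>n. \<Sum>t<n. \<alpha> t *\<^sub>R D t \<omega>)"
proof -
  have sq: "integrable M (\<lambda>\<omega>. (D t \<omega> $ i)\<^sup>2) \<and> (\<integral>\<omega>. (D t \<omega> $ i)\<^sup>2 \<partial>M) \<le> 2 * \<rho> + 2 * B\<^sup>2" for t i
  proof -
    let ?h = "\<lambda>\<omega>. 2 * (norm (b t \<omega> + D t \<omega>))\<^sup>2 + 2 * B\<^sup>2"
    have le: "AE \<omega> in M. (D t \<omega> $ i)\<^sup>2 \<le> ?h \<omega>"
      using b_bounded[of t]
    proof eventually_elim
      case (elim \<omega>)
      have "(D t \<omega> $ i)\<^sup>2 \<le> (norm (D t \<omega>))\<^sup>2"
        using component_le_norm_cart[of "D t \<omega>" i] by (simp add: abs_le_square_iff[symmetric])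
      moreover have "(norm (D t \<omega>))\<^sup>2 \<le> 2 * (norm (b t \<omega> + D t \<omega>))\<^sup>2 + 2 * (norm (b t \<omega>))\<^sup>2"
        using norm_diff_square_le[of "b t \<omega> + D t \<omega>" "b t \<omega>"] by simp
      moreover have "(norm (b t \<omega>))\<^sup>2 \<le> B\<^sup>2" using elim by (intro power_mono) auto
      ultimately show ?case by linarith
    qed
    have h: "integrable M ?h" using g_square by auto
    have int: "integrable M (\<lambda>\<omega>. (D t \<omega> $ i)\<^sup>2)"
    proof (rule Bochner_Integration.integrable_bound[OF h])
      show "AE \<omega> in M. norm ((D t \<omega> $ i)\<^sup>2) \<le> norm (?h \<omega>)"
        using le by eventually_elim simp
    qed measurable
    have "(\<integral>\<omega>. (D t \<omega> $ i)\<^sup>2 \<partial>M) \<le> (\<integral>\<omega>. ?h \<omega> \<partial>M)"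
      by (rule integral_mono_AE[OF int h le])
    also have "\<dots> \<le> 2 * \<rho> + 2 * B\<^sup>2" using g_square[of t] by (simp add: prob_space)
    finally show ?thesis using int by blast
  qed
  have "AE \<omega> in M. convergent (\<lambda>n. \<Sum>t<n. \<alpha> t * D t \<omega> $ i)" for i
  proof (rule martingale_series_convergent[where F = F, OF F_subalgebra F_Suc])
    note [measurable] = D_measurable
    show "(\<lambda>\<omega>. \<alpha> n * D n \<omega> $ i) \<in> borel_measurable (F (Suc n))" for n by measurable
    show "integrable M (\<lambda>\<omega>. (\<alpha> n * D n \<omega> $ i)\<^sup>2)" for n
      using sq by (simp add: power_mult_distrib)
    show "(\<integral>\<omega>. \<phi> \<omega> * (\<alpha> n * D n \<omega> $ i) \<partial>M) = 0"
      if \<phi>: "\<phi> \<in> borel_measurable (F n)" "\<And>\<omega>. \<bar>\<phi> \<omega>\<bar> \<le> C" for n \<phi> C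
    proof -
      have "integrable M \<phi>"
        by (rule integrable_const_bound[where B = C])
          (use \<phi> in \<open>auto intro: measurable_from_subalg[OF F_subalgebra]\<close>)
      then have "(\<integral>\<omega>. \<alpha> n * (\<phi> \<omega> * D n \<omega> $ i) \<partial>M) = 0"
        using D_orthogonal[OF \<phi>(1), of i] by simp
      then show ?thesis by (simp add: mult.left_commute)
    qed
    show "summable (\<lambda>n. \<integral>\<omega>. (\<alpha> n * D n \<omega> $ i)\<^sup>2 \<partial>M)"
      by (rule summable_comparison_test'[OF summable_mult[OF \<alpha>_square, of "2 * \<rho> + 2 * B\<^sup>2"], of 0])
        (use sq[THEN conjunct2] in \<open>auto simp: power_mult_distrib abs_mult mult.commute intro!: mult_left_mono\<close>)
  qed
  then have "AE \<omega> in M. \<forall>i. convergent (\<lambda>n. \<Sum>t<n. \<alpha> t * D t \<omega> $ i)"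
    by (subst AE_all_countable) auto
  then show ?thesis
    by eventually_elim (auto intro!: convergent_vec)
qed

abbreviation "x t \<omega> \<equiv> z t \<omega> - c' *\<^sub>R m t \<omega>"
abbreviation "\<psi> t \<omega> \<equiv> min ((norm (grad_f (x t \<omega>)))\<^sup>2) (norm (grad_f (x t \<omega>)))"

lemma AE_gradient_summable: "AE \<omega> in M. summable (\<lambda>t. \<alpha> t * \<psi> t \<omega>)"
proof -
  define K where "K = c * L * c' * B / 2"
  define \<Lambda> where "\<Lambda> = K / (1 - \<beta>)"
  define K' where "K' = L * c\<^sup>2 + \<Lambda> / (1 - \<beta>)"
  define U where "U t \<omega> = f (z t \<omega>) - f_star + \<Lambda> * (norm (m t \<omega>))\<^sup>2" for t \<omega>
  have "AE \<omega> in M. 0 \<le> B" using b_bounded[of 0] by eventually_elim (meson norm_ge_zero order_trans)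
  then have B0: "0 \<le> B" by simp
  have K0: "0 \<le> K" "0 \<le> \<Lambda>" "0 \<le> K'" using pos B0 by (auto simp: K_def \<Lambda>_def K'_def)
  have U0: "0 \<le> U t \<omega>" and f_le_U: "f (z t \<omega>) - f_star \<le> U t \<omega>" for t \<omega>
    using below[of "z t \<omega>"] K0 by (auto simp: U_def)
  have U_F: "U t \<in> borel_measurable (F t)" for t
  proof -
    note [measurable] = z_measurable[of t] m_measurable[of t]
    show ?thesis unfolding U_def[abs_def] by measurable
  qed
  have U_M [measurable]: "U t \<in> borel_measurable M" for t
    by (rule measurable_from_subalg[OF F_subalgebra U_F])
  have step: "AE \<omega> in M. U (Suc t) \<omega> + c * \<alpha> t * (\<kappa> * \<psi> t \<omega>)
      \<le> U t \<omega> - c * \<alpha> t * inner (grad_f (z t \<omega>)) (D t \<omega>)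
        + (K + K' * (norm (b t \<omega> + D t \<omega>))\<^sup>2) * (\<alpha> t)\<^sup>2" for t
    using b_bounded[of t] b_descent[of t] AE_space
  proof eventually_elim
    case (elim \<omega>)
    show ?case
      using momentum_lyapunov_step[OF gradient lipschitz _ _ _ _ _ _ elim(1,2) refl,
          of \<beta> c "\<alpha> t" "D t \<omega>"] pos \<alpha>_pos[of t]
      by (simp add: U_def z_Suc[OF elim(3)] m_Suc[OF elim(3)] K'_def \<Lambda>_def K_def algebra_simps)
  qed
  have summable_on: "AE \<omega> in M. U 0 \<omega> \<le> real k \<longrightarrow> summable (\<lambda>t. \<alpha> t * \<psi> t \<omega>)" for k
  proof -
    \<comment> \<open>\<open>U 0\<close> need not be integrable, because the initialization is
      arbitrary. The indicator \<open>I\<close> is measurable at time 0, hence at every time, and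
      may multiply any test function for \<open>D\<close>.\<close>
    define I where "I \<omega> = (if U 0 \<omega> \<le> real k then 1 else 0 :: real)" for \<omega>
    have I01: "0 \<le> I \<omega>" "I \<omega> \<le> 1" for \<omega> by (auto simp: I_def)
    have I_F: "I \<in> borel_measurable (F t)" for t
    proof -
      have "U 0 \<in> borel_measurable (F t)"
      proof (induction t)
        case (Suc t)
        show ?case by (rule measurable_from_subalg[OF F_Suc Suc])
      qed (rule U_F)
      note [measurable] = this
      show ?thesis unfolding I_def[abs_def] by measurable
    qed
    have I_M [measurable]: "I \<in> borel_measurable M"
      by (rule measurable_from_subalg[OF F_subalgebra I_F])
    have \<psi>0: "0 \<le> \<psi> t \<omega>" for t \<omega> by simp
    have one_step: "integrable M (\<lambda>\<omega>. I \<omega> * U (Suc t) \<omega>) \<and> integrable M (\<lambda>\<omega>. I \<omega> * (\<alpha> t * \<psi> t \<omega>)) \<and>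
        (\<integral>\<omega>. I \<omega> * U (Suc t) \<omega> \<partial>M) + c * \<kappa> * (\<integral>\<omega>. I \<omega> * (\<alpha> t * \<psi> t \<omega>) \<partial>M)
          \<le> (\<integral>\<omega>. I \<omega> * U t \<omega> \<partial>M) + (K + K' * \<rho>) * (\<alpha> t)\<^sup>2"
      if int: "integrable M (\<lambda>\<omega>. I \<omega> * U t \<omega>)" for t
    proof -
      define P where "P \<omega> = I \<omega> * inner (grad_f (z t \<omega>)) (D t \<omega>)" for \<omega>
      define R where "R \<omega> = I \<omega> * (K + K' * (norm (b t \<omega> + D t \<omega>))\<^sup>2)" for \<omega>
      \<comment> \<open>The right-hand side of \<open>step\<close> restricted by \<open>I\<close>;
        its noise part \<open>P\<close> has zero mean.\<close>
      define W where "W \<omega> = I \<omega> * U t \<omega> - c * \<alpha> t * P \<omega> + R \<omega> * (\<alpha> t)\<^sup>2" for \<omega>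
      have grad_F: "(\<lambda>\<omega>. I \<omega> * grad_f (z t \<omega>) $ i) \<in> borel_measurable (F t)" for i
      proof -
        have [measurable]: "(\<lambda>\<omega>. grad_f (z t \<omega>) $ i) \<in> borel_measurable (F t)"
          by (rule measurable_compose[OF z_measurable]) measurable
        note [measurable] = I_F[of t]
        show ?thesis by measurable
      qed
      \<comment> \<open>Orthogonality of \<open>D\<close> is used with an unbounded but integrable
        test function: the gradient norm is at most 1 plus its square, and
        \<open>norm_gradient_square_le\<close> bounds the square by a multiple of
        \<open>U\<close>.\<close>
      have grad_int: "integrable M (\<lambda>\<omega>. I \<omega> * grad_f (z t \<omega>) $ i)" for i
      proof (rule Bochner_Integration.integrable_bound)
        show "integrable M (\<lambda>\<omega>. 1 + 4 * L * (I \<omega> * U t \<omega>))" using int by simp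
        show "AE \<omega> in M. norm (I \<omega> * grad_f (z t \<omega>) $ i) \<le> norm (1 + 4 * L * (I \<omega> * U t \<omega>))"
        proof (rule AE_I2)
          fix \<omega>
          let ?g = "norm (grad_f (z t \<omega>))"
          have "\<bar>grad_f (z t \<omega>) $ i\<bar> \<le> ?g" by (rule component_le_norm_cart)
          also have "?g \<le> 1 + ?g\<^sup>2" using sum_squares_bound[of ?g 1] by (simp add: power2_eq_square) (smt (verit) zero_le_square)
          also have "\<dots> \<le> 1 + 4 * L * (f (z t \<omega>) - f_star)"
            using norm_gradient_square_le[OF gradient lipschitz pos(1) below] by simp
          also have "\<dots> \<le> 1 + 4 * L * U t \<omega>"
            using f_le_U[of t \<omega>] pos by simp
          finally have "I \<omega> * \<bar>grad_f (z t \<omega>) $ i\<bar> \<le> 1 + 4 * L * (I \<omega> * U t \<omega>)"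
            by (simp add: I_def)
          then show "norm (I \<omega> * grad_f (z t \<omega>) $ i) \<le> norm (1 + 4 * L * (I \<omega> * U t \<omega>))"
            using I01[of \<omega>] by (simp add: abs_mult)
        qed
      qed measurable
      have P_eq: "P \<omega> = (\<Sum>i\<in>UNIV. (I \<omega> * grad_f (z t \<omega>) $ i) * D t \<omega> $ i)" for \<omega>
        by (simp add: P_def inner_vec_def sum_distrib_left mult.assoc)
      have P: "integrable M P" "(\<integral>\<omega>. P \<omega> \<partial>M) = 0"
        unfolding P_eq[abs_def] using D_orthogonal[OF grad_F grad_int]
        by (auto simp: Bochner_Integration.integral_sum)
      have G: "integrable M (\<lambda>\<omega>. K + K' * (norm (b t \<omega> + D t \<omega>))\<^sup>2)" using g_square by auto
      have R_le: "R \<omega> \<le> K + K' * (norm (b t \<omega> + D t \<omega>))\<^sup>2" and R0: "0 \<le> R \<omega>" for \<omega>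
        using K0 by (auto simp: R_def I_def)
      have R: "integrable M R"
        by (rule Bochner_Integration.integrable_bound[OF G])
          (use R_le R0 in \<open>auto simp: R_def[abs_def] intro: order_trans[OF _ abs_ge_self]\<close>)
      have "(\<integral>\<omega>. R \<omega> \<partial>M) \<le> (\<integral>\<omega>. K + K' * (norm (b t \<omega> + D t \<omega>))\<^sup>2 \<partial>M)"
        by (rule integral_mono[OF R G R_le])
      also have "\<dots> = K + K' * (\<integral>\<omega>. (norm (b t \<omega> + D t \<omega>))\<^sup>2 \<partial>M)"
        using g_square by (simp add: prob_space)
      also have "\<dots> \<le> K + K' * \<rho>"
        using g_square K0 by (intro add_left_mono mult_left_mono) auto
      finally have "(\<integral>\<omega>. R \<omega> \<partial>M) * (\<alpha> t)\<^sup>2 \<le> (K + K' * \<rho>) * (\<alpha> t)\<^sup>2"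
        by (intro mult_right_mono) auto
      moreover have W: "integrable M W" unfolding W_def[abs_def] using int P R by auto
      moreover have "(\<integral>\<omega>. W \<omega> \<partial>M) = (\<integral>\<omega>. I \<omega> * U t \<omega> \<partial>M) + (\<integral>\<omega>. R \<omega> \<partial>M) * (\<alpha> t)\<^sup>2"
        unfolding W_def[abs_def] using int P R by simp
      ultimately have W_le: "(\<integral>\<omega>. W \<omega> \<partial>M) \<le> (\<integral>\<omega>. I \<omega> * U t \<omega> \<partial>M) + (K + K' * \<rho>) * (\<alpha> t)\<^sup>2"
        by simp
      have le: "AE \<omega> in M. I \<omega> * U (Suc t) \<omega> + c * \<kappa> * (I \<omega> * (\<alpha> t * \<psi> t \<omega>)) \<le> W \<omega>"
        using step[of t]
      proof eventually_elim
        case (elim \<omega>)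
        then show ?case
          by (cases "U 0 \<omega> \<le> real k") (simp_all add: I_def W_def P_def R_def mult.assoc mult.left_commute)
      qed
      have nonneg: "0 \<le> I \<omega> * U (Suc t) \<omega>" "0 \<le> c * \<kappa> * (I \<omega> * (\<alpha> t * \<psi> t \<omega>))" for \<omega>
        using I01[of \<omega>] U0[of "Suc t" \<omega>] \<alpha>_pos[of t] pos by auto
      \<comment> \<open>The two terms on the left of \<open>le\<close> are nonnegative, so each of
        them is dominated by \<open>W\<close>. This passes integrability on from \<open>t\<close> to
        \<open>Suc t\<close>.\<close>
      have i1: "integrable M (\<lambda>\<omega>. I \<omega> * U (Suc t) \<omega>)"
      proof (rule Bochner_Integration.integrable_bound[OF W])
        show "AE \<omega> in M. norm (I \<omega> * U (Suc t) \<omega>) \<le> norm (W \<omega>)"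
          using le
        proof eventually_elim
          case (elim \<omega>)
          then show ?case using nonneg[of \<omega>] unfolding real_norm_def by linarith
        qed
      qed measurable
      have i2: "integrable M (\<lambda>\<omega>. c * \<kappa> * (I \<omega> * (\<alpha> t * \<psi> t \<omega>)))"
      proof (rule Bochner_Integration.integrable_bound[OF W])
        show "AE \<omega> in M. norm (c * \<kappa> * (I \<omega> * (\<alpha> t * \<psi> t \<omega>))) \<le> norm (W \<omega>)"
          using le
        proof eventually_elim
          case (elim \<omega>)
          then show ?case using nonneg[of \<omega>] unfolding real_norm_def by linarith
        qed
      qed measurable
      have i3: "integrable M (\<lambda>\<omega>. I \<omega> * (\<alpha> t * \<psi> t \<omega>))"
        using integrable_divide[OF i2, of "c * \<kappa>"] pos by simp
      have "(\<integral>\<omega>. I \<omega> * U (Suc t) \<omega> \<partial>M) + c * \<kappa> * (\<integral>\<omega>. I \<omega> * (\<alpha> t * \<psi> t \<omega>) \<partial>M)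
          = (\<integral>\<omega>. I \<omega> * U (Suc t) \<omega> + c * \<kappa> * (I \<omega> * (\<alpha> t * \<psi> t \<omega>)) \<partial>M)"
        using i1 i2 i3 by simp
      also have "\<dots> \<le> (\<integral>\<omega>. W \<omega> \<partial>M)"
        using i1 i2 W le by (intro integral_mono_AE) auto
      finally show ?thesis using W_le i1 i3 by linarith
    qed
    have int0: "integrable M (\<lambda>\<omega>. I \<omega> * U 0 \<omega>)"
      by (rule integrable_const_bound[where B = "real k"]) (auto simp: I_def U0)
    have intU: "integrable M (\<lambda>\<omega>. I \<omega> * U t \<omega>)" for t
      by (induction t) (use int0 one_step in auto)
    have int\<psi>: "integrable M (\<lambda>\<omega>. I \<omega> * (\<alpha> t * \<psi> t \<omega>))" for t
      using one_step[OF intU] by blast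
    let ?a = "\<lambda>t. \<integral>\<omega>. I \<omega> * U t \<omega> \<partial>M" and ?p = "\<lambda>t. \<integral>\<omega>. I \<omega> * (\<alpha> t * \<psi> t \<omega>) \<partial>M"
    have "0 \<le> \<rho>" using g_square(2)[of 0] by (rule order_trans[rotated]) simp
    then have K\<rho>: "0 \<le> K + K' * \<rho>" using K0 by simp
    have total: "?a n + c * \<kappa> * (\<Sum>t<n. ?p t) \<le> ?a 0 + (K + K' * \<rho>) * (\<Sum>t<n. (\<alpha> t)\<^sup>2)" for n
    proof (induction n)
      case (Suc n)
      have "?a (Suc n) + c * \<kappa> * ?p n \<le> ?a n + (K + K' * \<rho>) * (\<alpha> n)\<^sup>2"
        using one_step[OF intU] by blast
      with Suc show ?case by (simp only: sum.lessThan_Suc distrib_left)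
    qed simp
    have "summable ?p"
    proof (rule summableI_nonneg_bounded)
      show "0 \<le> ?p t" for t using I01 \<alpha>_pos[of t] by (auto intro!: integral_nonneg)
      fix n
      have "0 \<le> ?a n" using I01 U0 by (auto intro!: integral_nonneg)
      moreover have "(K + K' * \<rho>) * (\<Sum>t<n. (\<alpha> t)\<^sup>2) \<le> (K + K' * \<rho>) * (\<Sum>t. (\<alpha> t)\<^sup>2)"
        using K\<rho> \<alpha>_square by (intro mult_left_mono sum_le_suminf) auto
      ultimately have "c * \<kappa> * (\<Sum>t<n. ?p t) \<le> ?a 0 + (K + K' * \<rho>) * (\<Sum>t. (\<alpha> t)\<^sup>2)"
        using total[of n] by linarith
      then show "(\<Sum>t<n. ?p t) \<le> (?a 0 + (K + K' * \<rho>) * (\<Sum>t. (\<alpha> t)\<^sup>2)) / (c * \<kappa>)"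
        using pos by (simp add: pos_le_divide_eq mult.commute)
    qed
    then have "AE \<omega> in M. summable (\<lambda>t. I \<omega> * (\<alpha> t * \<psi> t \<omega>))"
      using I01 \<alpha>_pos less_imp_le[OF \<alpha>_pos] int\<psi> by (intro AE_summable_of_summable_integral) auto
    then show ?thesis by eventually_elim (auto simp: I_def)
  qed
  \<comment> \<open>The events \<open>U 0 \<omega> \<le> real k\<close> exhaust the space, and there
    are only countably many of them.\<close>
  then have "AE \<omega> in M. \<forall>k. U 0 \<omega> \<le> real k \<longrightarrow> summable (\<lambda>t. \<alpha> t * \<psi> t \<omega>)"
    by (subst AE_all_countable) auto
  then show ?thesis
    by eventually_elim (use real_arch_simple in blast)
qed

theorem AE_gradient_tendsto_0: "AE \<omega> in M. (\<lambda>t. norm (grad_f (x t \<omega>))) \<longlonglongrightarrow> 0"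
proof -
  have "AE \<omega> in M. \<forall>t. norm (b t \<omega>) \<le> B" using b_bounded by (subst AE_all_countable) auto
  with AE_summable_step_square AE_noise_series_convergent AE_gradient_summable AE_space
  show ?thesis
  proof eventually_elim
    case (elim \<omega>)
    note \<omega> = elim(4)
    have B0: "0 \<le> B" using elim(5) norm_ge_zero order_trans by blast
    \<comment> \<open>The squared momentum contracts by \<open>\<beta>\<close> up to a summable
      error, so it is summable and the momentum vanishes.\<close>
    have "summable (\<lambda>t. (norm (m t \<omega>))\<^sup>2)"
    proof (rule summable_contraction[where \<beta> = \<beta>])
      show "summable (\<lambda>t. (norm (\<alpha> t *\<^sub>R (b t \<omega> + D t \<omega>)))\<^sup>2 / (1 - \<beta>))"
        using elim(1) by (intro summable_divide) (simp add: power_mult_distrib mult.commute)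
      show "(norm (m (Suc n) \<omega>))\<^sup>2 \<le> \<beta> * (norm (m n \<omega>))\<^sup>2
          + (norm (\<alpha> n *\<^sub>R (b n \<omega> + D n \<omega>)))\<^sup>2 / (1 - \<beta>)" for n
        unfolding m_Suc[OF \<omega>] by (rule norm_square_convex_step) (use pos in auto)
    qed (use pos in auto)
    then have "(\<lambda>t. sqrt ((norm (m t \<omega>))\<^sup>2)) \<longlonglongrightarrow> sqrt 0"
      by (intro tendsto_real_sqrt summable_LIMSEQ_zero)
    then have m0: "(\<lambda>t. m t \<omega>) \<longlonglongrightarrow> 0" by (simp add: tendsto_norm_zero_iff)
    \<comment> \<open>\<open>e\<close> gathers everything in \<open>x\<close> that converges, the
      noise series and the momentum offset. What remains of the movement of \<open>x\<close> is the
      drift by \<open>b\<close>, at most \<open>c * B\<close> per unit of step length.\<close>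
    define e where "e n = c *\<^sub>R (\<Sum>t<n. \<alpha> t *\<^sub>R D t \<omega>) + c' *\<^sub>R m n \<omega>" for n
    obtain s where "(\<lambda>n. \<Sum>t<n. \<alpha> t *\<^sub>R D t \<omega>) \<longlonglongrightarrow> s" using elim(2) by (auto simp: convergent_def)
    then have "(\<lambda>n. L *\<^sub>R e n) \<longlonglongrightarrow> L *\<^sub>R (c *\<^sub>R s + c' *\<^sub>R 0)"
      unfolding e_def by (intro tendsto_intros m0)
    then have e: "Cauchy (\<lambda>n. L *\<^sub>R e n)" by (rule LIMSEQ_imp_Cauchy)
    have z_eq: "z n \<omega> = z 0 \<omega> - c *\<^sub>R (\<Sum>t<n. \<alpha> t *\<^sub>R b t \<omega>) - c *\<^sub>R (\<Sum>t<n. \<alpha> t *\<^sub>R D t \<omega>)" for n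
      by (induction n) (simp_all add: z_Suc[OF \<omega>] scaleR_add_right algebra_simps)
    show ?case
    proof (rule tendsto_0_of_weighted_sum[where C = "L * c * B" and \<alpha> = \<alpha>, OF _ _ _ _ \<alpha>_sum elim(3) e])
      have "(\<lambda>t. sqrt ((\<alpha> t)\<^sup>2)) \<longlonglongrightarrow> sqrt 0"
        by (intro tendsto_real_sqrt summable_LIMSEQ_zero \<alpha>_square)
      then show "\<alpha> \<longlonglongrightarrow> 0" using less_imp_le[OF \<alpha>_pos] by simp
      fix k n :: nat assume "k \<le> n"
      have "x n \<omega> - x k \<omega> = - (c *\<^sub>R ((\<Sum>t<n. \<alpha> t *\<^sub>R b t \<omega>) - (\<Sum>t<k. \<alpha> t *\<^sub>R b t \<omega>))) - (e n - e k)"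
        unfolding e_def by (subst (1 2) z_eq) (simp add: algebra_simps)
      also have "(\<Sum>t<n. \<alpha> t *\<^sub>R b t \<omega>) - (\<Sum>t<k. \<alpha> t *\<^sub>R b t \<omega>) = (\<Sum>t=k..<n. \<alpha> t *\<^sub>R b t \<omega>)"
        using \<open>k \<le> n\<close> sum_diff_nat_ivl[of 0 k n "\<lambda>t. \<alpha> t *\<^sub>R b t \<omega>"] by (simp add: lessThan_atLeast0)
      finally have "norm (x n \<omega> - x k \<omega>) \<le> norm (c *\<^sub>R (\<Sum>t=k..<n. \<alpha> t *\<^sub>R b t \<omega>)) + norm (e n - e k)"
        using norm_triangle_ineq4[of "- (c *\<^sub>R (\<Sum>t=k..<n. \<alpha> t *\<^sub>R b t \<omega>))" "e n - e k"] by simp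
      also have "norm (c *\<^sub>R (\<Sum>t=k..<n. \<alpha> t *\<^sub>R b t \<omega>)) \<le> c * (\<Sum>t=k..<n. \<alpha> t * B)"
        using pos elim(5) less_imp_le[OF \<alpha>_pos]
        by (auto intro!: mult_left_mono sum_norm_le)
      finally have "L * norm (x n \<omega> - x k \<omega>) \<le> L * (c * (\<Sum>t=k..<n. \<alpha> t * B) + norm (e n - e k))"
        using pos by (intro mult_left_mono) auto
      moreover have "norm (grad_f (x n \<omega>)) - norm (grad_f (x k \<omega>)) \<le> L * norm (x n \<omega> - x k \<omega>)"
        using norm_triangle_ineq2[of "grad_f (x n \<omega>)" "grad_f (x k \<omega>)"] lipschitz
        by (rule order_trans)
      ultimately have "norm (grad_f (x n \<omega>)) - norm (grad_f (x k \<omega>))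
          \<le> L * (c * (\<Sum>t=k..<n. \<alpha> t * B) + norm (e n - e k))" by (rule order_trans[rotated])
      also have "\<dots> = L * c * B * (\<Sum>t=k..<n. \<alpha> t) + norm (L *\<^sub>R e n - L *\<^sub>R e k)"
        unfolding scaleR_right_diff_distrib[symmetric] norm_scaleR sum_distrib_right[symmetric]
        using pos by (simp add: distrib_left)
      finally show "norm (grad_f (x n \<omega>)) - norm (grad_f (x k \<omega>))
          \<le> L * c * B * (\<Sum>t=k..<n. \<alpha> t) + norm (L *\<^sub>R e n - L *\<^sub>R e k)" .
    qed (use pos B0 less_imp_le[OF \<alpha>_pos] in auto)
  qed
qed

end

section \<open>Gaussian noise and the natural filtration\<close>

text \<open>A coordinate is \<open>s\<close> times a standard normal variable. Integrating against
  the standard normal density also covers the degenerate case \<open>s = 0\<close>.\<close>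

lemma isotropic_gaussian_component_moments:
  fixes i :: "'d::finite"
  shows "integrable (isotropic_gaussian s) (\<lambda>v :: real ^ 'd. v $ i)"
    "(\<integral>v. v $ i \<partial>(isotropic_gaussian s :: (real ^ 'd) measure)) = 0"
    "integrable (isotropic_gaussian s) (\<lambda>v :: real ^ 'd. (v $ i)\<^sup>2)"
    "(\<integral>v. (v $ i)\<^sup>2 \<partial>(isotropic_gaussian s :: (real ^ 'd) measure)) = s\<^sup>2"
proof -
  let ?N = "density lborel (\<lambda>u. ennreal (std_normal_density u)) :: real measure"
  let ?P = "\<Pi>\<^sub>M i\<in>(UNIV :: 'd set). ?N"
  let ?T = "\<lambda>u :: 'd \<Rightarrow> real. s *\<^sub>R (\<chi> i. u i) :: real ^ 'd"
  have T [measurable]: "?T \<in> borel_measurable ?P"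
  proof (subst borel_measurable_euclidean_space, intro ballI)
    fix k :: "real ^ 'd" assume "k \<in> Basis"
    then obtain j where "k = axis j 1" by (auto simp: Basis_vec_def)
    then have "(\<lambda>u. inner (?T u) k) = (\<lambda>u. s * u j)" by (auto simp: inner_axis)
    then show "(\<lambda>u. inner (?T u) k) \<in> borel_measurable ?P" by simp
  qed
  have marginal: "distr ?P ?N (\<lambda>u. u i) = ?N"
    by (rule distr_PiM_component) (auto intro: prob_space_normal_density)
  \<comment> \<open>Two changes of variables: from the Gaussian vector to the product measure, then
    to the single factor \<open>i\<close> through \<open>marginal\<close>.\<close>
  have comp: "(integrable (isotropic_gaussian s) (\<lambda>v :: real ^ 'd. h (v $ i))
      \<longleftrightarrow> integrable lborel (\<lambda>u. std_normal_density u * h (s * u)))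
    \<and> (\<integral>v. h (v $ i) \<partial>(isotropic_gaussian s :: (real ^ 'd) measure))
      = (\<integral>u. std_normal_density u * h (s * u) \<partial>lborel)"
    if [measurable]: "h \<in> borel_measurable borel" for h :: "real \<Rightarrow> real"
  proof -
    have hN [measurable]: "(\<lambda>u. h (s * u)) \<in> borel_measurable ?N" by simp
    have "integrable (isotropic_gaussian s) (\<lambda>v :: real ^ 'd. h (v $ i))
        \<longleftrightarrow> integrable ?P (\<lambda>u. h (s * u i))"
      unfolding isotropic_gaussian_def by (subst integrable_distr_eq) auto
    also have "\<dots> \<longleftrightarrow> integrable (distr ?P ?N (\<lambda>u. u i)) (\<lambda>u. h (s * u))"
      by (subst integrable_distr_eq) auto
    also have "\<dots> \<longleftrightarrow> integrable lborel (\<lambda>u. std_normal_density u * h (s * u))"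
      unfolding marginal by (subst integrable_density) auto
    finally have 1: "integrable (isotropic_gaussian s) (\<lambda>v :: real ^ 'd. h (v $ i)) \<longleftrightarrow> \<dots>" .
    have "(\<integral>v. h (v $ i) \<partial>(isotropic_gaussian s :: (real ^ 'd) measure)) = (\<integral>u. h (s * u i) \<partial>?P)"
      unfolding isotropic_gaussian_def by (subst integral_distr) auto
    also have "\<dots> = (\<integral>u. h (s * u) \<partial>distr ?P ?N (\<lambda>u. u i))"
      by (subst integral_distr) auto
    also have "\<dots> = (\<integral>u. std_normal_density u * h (s * u) \<partial>lborel)"
      unfolding marginal by (subst integral_density) auto
    finally show ?thesis using 1 by blast
  qed
  have m1: "has_bochner_integral lborel (\<lambda>u. std_normal_density u * u) 0"
    using std_normal_moment_odd[of 0] by simp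
  have m2: "has_bochner_integral lborel (\<lambda>u. std_normal_density u * u\<^sup>2) 1"
    using std_normal_moment_even[of 1] by (simp add: fact_numeral)
  have m1': "has_bochner_integral lborel (\<lambda>u. std_normal_density u * (s * u)) 0"
    using has_bochner_integral_mult_right[OF m1, of s] by (simp add: mult.left_commute)
  have m2': "has_bochner_integral lborel (\<lambda>u. std_normal_density u * (s * u)\<^sup>2) (s\<^sup>2)"
    using has_bochner_integral_mult_right[OF m2, of "s\<^sup>2"]
    by (simp add: mult.left_commute power_mult_distrib)
  show "integrable (isotropic_gaussian s) (\<lambda>v :: real ^ 'd. v $ i)"
    "(\<integral>v. v $ i \<partial>(isotropic_gaussian s :: (real ^ 'd) measure)) = 0"
    using comp[of "\<lambda>u. u"] m1' by (auto simp: has_bochner_integral_iff)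
  show "integrable (isotropic_gaussian s) (\<lambda>v :: real ^ 'd. (v $ i)\<^sup>2)"
    "(\<integral>v. (v $ i)\<^sup>2 \<partial>(isotropic_gaussian s :: (real ^ 'd) measure)) = s\<^sup>2"
    using comp[of "\<lambda>u. u\<^sup>2"] m2' by (auto simp: has_bochner_integral_iff)
qed

lemma space_natural_filtration [simp]: "space (natural_filtration M S I \<xi> \<zeta> t) = space M"
  by (simp add: natural_filtration_def space_measure_of_conv)

lemma sets_natural_filtration:
  "sets (natural_filtration M S I \<xi> \<zeta> t) = sigma_sets (space M)
     ((\<Union>Z\<in>I. sets (vimage_algebra (space M) Z borel)) \<union>
      (\<Union>s\<in>{1..<t}. sets (vimage_algebra (space M) (\<xi> s) S)) \<union>
      (\<Union>s\<in>{1..<t}. sets (vimage_algebra (space M) (\<zeta> s) borel)))"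
  unfolding natural_filtration_def
  using sets.sets_into_space by (intro sets_measure_of) fastforce

lemma sets_past_and_sample:
  "sets (past_and_sample M S I \<xi> \<zeta> t) = sigma_sets (space M)
     (sets (natural_filtration M S I \<xi> \<zeta> t) \<union> sets (vimage_algebra (space M) (\<xi> t) S))"
  unfolding past_and_sample_def
  using sets.sets_into_space[of _ "natural_filtration M S I \<xi> \<zeta> t"] sets.sets_into_space
  by (intro sets_measure_of) fastforce

lemma measurable_if_vimage_algebra_subset:
  assumes "Z \<in> space A \<rightarrow> space N" "sets (vimage_algebra (space A) Z N) \<subseteq> sets A"
  shows "Z \<in> measurable A N"
  using assms by (auto simp: measurable_def sets_vimage_algebra2)

lemma sigma_sets_vimage_subset:
  assumes "X \<in> measurable N K" "space N = \<Omega>"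
  shows "sigma_sets \<Omega> {X -` A \<inter> \<Omega> |A. A \<in> sets K} \<subseteq> sets N"
  unfolding assms(2)[symmetric]
  by (intro sets.sigma_sets_subset) (auto intro: measurable_sets[OF assms(1)])

context prob_space
begin

lemma indep_set_subset:
  assumes "indep_set A B" "A' \<subseteq> A" "B' \<subseteq> B"
  shows "indep_set A' B'"
  using assms unfolding indep_sets2_eq by blast

text \<open>\<open>X\<close> need not be integrable: the weight \<open>1 / (1 + \<bar>g\<bar>)\<close> makes it bounded, and is
  divided out again.\<close>

lemma integral_mult_diff_real_cond_exp:
  fixes X g \<phi> :: "'a \<Rightarrow> real"
  assumes N: "subalgebra M N"
    and X [measurable]: "X \<in> borel_measurable M" and g: "g \<in> borel_measurable N"
    and cond: "AE \<omega> in M. real_cond_exp M N X \<omega> = g \<omega>"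
    and bound: "AE \<omega> in M. \<bar>X \<omega> - g \<omega>\<bar> \<le> \<sigma>"
    and \<phi>: "\<phi> \<in> borel_measurable N" "integrable M \<phi>"
  shows "integrable M (\<lambda>\<omega>. \<phi> \<omega> * (X \<omega> - g \<omega>)) \<and> (\<integral>\<omega>. \<phi> \<omega> * (X \<omega> - g \<omega>) \<partial>M) = 0"
proof -
  interpret finite_measure_subalgebra M N by unfold_locales (rule N)
  define w where "w \<omega> = 1 / (1 + \<bar>g \<omega>\<bar>)" for \<omega>
  define h where "h \<omega> = w \<omega> * X \<omega> - w \<omega> * g \<omega>" for \<omega>
  have w0: "0 < w \<omega>" "w \<omega> \<le> 1" and wg: "w \<omega> * \<bar>g \<omega>\<bar> \<le> 1" for \<omega> by (auto simp: w_def)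
  have wN: "w \<in> borel_measurable N"
  proof -
    note [measurable] = g
    show ?thesis unfolding w_def[abs_def] by measurable
  qed
  have [measurable]: "w \<in> borel_measurable M" "g \<in> borel_measurable M" "\<phi> \<in> borel_measurable M"
    using wN g \<phi>(1) by (auto intro: measurable_from_subalg[OF N])
  have wX: "integrable M (\<lambda>\<omega>. w \<omega> * X \<omega>)"
  proof (rule integrable_const_bound)
    show "AE \<omega> in M. norm (w \<omega> * X \<omega>) \<le> 1 + \<sigma>"
      using bound
    proof eventually_elim
      case (elim \<omega>)
      have "norm (w \<omega> * X \<omega>) = w \<omega> * \<bar>X \<omega>\<bar>" using w0(1)[of \<omega>] by (simp add: abs_mult)
      also have "\<dots> \<le> w \<omega> * (\<bar>g \<omega>\<bar> + \<bar>X \<omega> - g \<omega>\<bar>)"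
        using w0(1)[of \<omega>] by (intro mult_left_mono) auto
      also have "\<dots> \<le> 1 + 1 * \<sigma>"
        unfolding distrib_left using w0[of \<omega>] elim by (intro add_mono mult_mono wg) auto
      finally show ?case by simp
    qed
  qed measurable
  have wg_int: "integrable M (\<lambda>\<omega>. w \<omega> * g \<omega>)"
    by (rule integrable_const_bound[where B = 1]) (use wg w0 in \<open>auto simp: abs_mult less_imp_le\<close>)
  have "AE \<omega> in M. real_cond_exp M N (\<lambda>\<omega>. w \<omega> * g \<omega>) \<omega> = w \<omega> * g \<omega>"
    using wN g by (intro real_cond_exp_F_meas wg_int) simp
  with cond real_cond_exp_mult[OF wN X wX] real_cond_exp_diff[OF wX wg_int]
  have rce0: "AE \<omega> in M. real_cond_exp M N h \<omega> = 0"
    unfolding h_def[abs_def] by eventually_elim simp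
  \<comment> \<open>Multiplying by \<open>1 + \<bar>g \<omega>\<bar>\<close> undoes the weight. The
    test function becomes larger, but its product with \<open>h\<close> is
    \<open>\<phi> * (X - g)\<close>, which is integrable by the bound
    \<open>\<sigma>\<close>.\<close>
  have eq: "\<phi> \<omega> * (1 + \<bar>g \<omega>\<bar>) * h \<omega> = \<phi> \<omega> * (X \<omega> - g \<omega>)" for \<omega>
  proof -
    have "(1 + \<bar>g \<omega>\<bar>) * w \<omega> = 1" by (simp add: w_def add_nonneg_eq_0_iff)
    then have "\<phi> \<omega> * ((1 + \<bar>g \<omega>\<bar>) * w \<omega>) * (X \<omega> - g \<omega>) = \<phi> \<omega> * (X \<omega> - g \<omega>)" by simp
    then show ?thesis by (simp add: h_def right_diff_distrib mult.assoc)
  qed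
  have int: "integrable M (\<lambda>\<omega>. \<phi> \<omega> * (X \<omega> - g \<omega>))"
  proof (rule Bochner_Integration.integrable_bound)
    show "integrable M (\<lambda>\<omega>. \<phi> \<omega> * \<sigma>)" using \<phi> by simp
    show "AE \<omega> in M. norm (\<phi> \<omega> * (X \<omega> - g \<omega>)) \<le> norm (\<phi> \<omega> * \<sigma>)"
      using bound by eventually_elim (auto simp: abs_mult intro!: mult_left_mono)
  qed measurable
  have "(\<lambda>\<omega>. \<phi> \<omega> * (1 + \<bar>g \<omega>\<bar>)) \<in> borel_measurable N"
    using \<phi>(1) g by measurable
  then have "(\<integral>\<omega>. \<phi> \<omega> * (1 + \<bar>g \<omega>\<bar>) * real_cond_exp M N h \<omega> \<partial>M)
      = (\<integral>\<omega>. \<phi> \<omega> * (1 + \<bar>g \<omega>\<bar>) * h \<omega> \<partial>M)"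
  proof (rule real_cond_exp_intg(2)[rotated])
    show "integrable M (\<lambda>\<omega>. \<phi> \<omega> * (1 + \<bar>g \<omega>\<bar>) * h \<omega>)" unfolding eq by (rule int)
    show "h \<in> borel_measurable M" unfolding h_def[abs_def] by measurable
  qed
  moreover have "(\<integral>\<omega>. \<phi> \<omega> * (1 + \<bar>g \<omega>\<bar>) * real_cond_exp M N h \<omega> \<partial>M) = (\<integral>\<omega>. 0 \<partial>M)"
  proof (rule integral_cong_AE)
    show "AE \<omega> in M. \<phi> \<omega> * (1 + \<bar>g \<omega>\<bar>) * real_cond_exp M N h \<omega> = 0"
      using rce0 by eventually_elim simp
  qed measurable
  ultimately show ?thesis using int by (simp add: eq)
qed

end

section \<open>The oracle model shared by the three methods, with the recursion left open\<close>

locale clipped_noisy_oracle = prob_space M for M :: "'w measure" +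
  fixes S :: "'s measure"
    and f :: "real ^ 'd \<Rightarrow> real" and grad_f :: "real ^ 'd \<Rightarrow> real ^ 'd"
    and G :: "real ^ 'd \<Rightarrow> 's \<Rightarrow> real ^ 'd"
    and \<xi> :: "nat \<Rightarrow> 'w \<Rightarrow> 's" and \<zeta> x :: "nat \<Rightarrow> 'w \<Rightarrow> real ^ 'd"
    and I :: "('w \<Rightarrow> real ^ 'd) set"
    and \<alpha> :: "nat \<Rightarrow> real" and f_star L q \<sigma> s :: real
  assumes below: "\<And>z. f_star \<le> f z"
    and gradient: "\<And>z. GDERIV f z :> grad_f z"
    and lipschitz: "\<And>z w. norm (grad_f z - grad_f w) \<le> L * norm (z - w)"
    and oracle_measurable: "(\<lambda>(z, s). G z s) \<in> borel_measurable (borel \<Otimes>\<^sub>M S)"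
    and sample_measurable: "\<And>t. t \<ge> 1 \<Longrightarrow> \<xi> t \<in> measurable M S"
    and noise_measurable: "\<And>t. t \<ge> 1 \<Longrightarrow> \<zeta> t \<in> borel_measurable M"
    and noise_gaussian: "\<And>t. t \<ge> 1 \<Longrightarrow> distr M borel (\<zeta> t) = isotropic_gaussian s"
    and noise_independent: "\<And>t. t \<ge> 1 \<Longrightarrow>
          indep_set (sets (past_and_sample M S I \<xi> \<zeta> t)) (sets (vimage_algebra (space M) (\<zeta> t) borel))"
    and unbiased: "\<And>t. t \<ge> 1 \<Longrightarrow>
          AE \<omega> in M. vec_cond_exp M (natural_filtration M S I \<xi> \<zeta> t)
            (\<lambda>\<omega>'. G (x t \<omega>') (\<xi> t \<omega>')) \<omega> = grad_f (x t \<omega>)"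
    and bounded_noise: "\<And>t. t \<ge> 1 \<Longrightarrow>
          AE \<omega> in M. norm (G (x t \<omega>) (\<xi> t \<omega>) - grad_f (x t \<omega>)) \<le> \<sigma>"
    and \<sigma>_nonneg: "0 \<le> \<sigma>" and \<sigma>_less: "\<sigma> < q"
    and step_pos: "\<And>t. t \<ge> 1 \<Longrightarrow> \<alpha> t > 0"
    and step_sum: "filterlim (\<lambda>n. \<Sum>t=1..n. \<alpha> t) at_top sequentially"
    and step_square_sum: "summable (\<lambda>t. (\<alpha> (t + 1))\<^sup>2)"
    and init_measurable: "\<And>Z. Z \<in> I \<Longrightarrow> Z \<in> borel_measurable M"
begin

abbreviation "past t \<equiv> natural_filtration M S I \<xi> \<zeta> t"
abbreviation "g \<omega> t \<equiv> clipped_noisy_grad q G \<xi> \<zeta> x \<omega> t"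

lemma generator_measurable:
  shows "Z \<in> I \<Longrightarrow> Z \<in> borel_measurable (past t)"
    and "1 \<le> k \<Longrightarrow> k < t \<Longrightarrow> \<xi> k \<in> measurable (past t) S"
    and "1 \<le> k \<Longrightarrow> k < t \<Longrightarrow> \<zeta> k \<in> borel_measurable (past t)"
proof -
  show "Z \<in> borel_measurable (past t)" if "Z \<in> I"
  proof (rule measurable_if_vimage_algebra_subset)
    show "sets (vimage_algebra (space (past t)) Z borel) \<subseteq> sets (past t)"
      unfolding sets_natural_filtration space_natural_filtration
      by (intro subsetI sigma_sets.Basic) (use that in blast)
  qed simp
  show "\<xi> k \<in> measurable (past t) S" if k: "1 \<le> k" "k < t"
  proof (rule measurable_if_vimage_algebra_subset)
    show "sets (vimage_algebra (space (past t)) (\<xi> k) S) \<subseteq> sets (past t)"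
      unfolding sets_natural_filtration space_natural_filtration
      by (intro subsetI sigma_sets.Basic UnI1 UnI2 UN_I[of k]) (use k in simp_all)
  qed (use measurable_space[OF sample_measurable[OF k(1)]] in simp)
  show "\<zeta> k \<in> borel_measurable (past t)" if k: "1 \<le> k" "k < t"
  proof (rule measurable_if_vimage_algebra_subset)
    show "sets (vimage_algebra (space (past t)) (\<zeta> k) borel) \<subseteq> sets (past t)"
      unfolding sets_natural_filtration space_natural_filtration
      by (intro subsetI sigma_sets.Basic UnI2 UN_I[of k]) (use k in simp_all)
  qed simp
qed

lemma subalgebra_past: "subalgebra M (past t)"
proof -
  have sub: "sets (vimage_algebra (space M) Z N) \<subseteq> sets M" if "Z \<in> measurable M N"
    for Z :: "'w \<Rightarrow> 'c" and N
    using that by (auto simp: sets_vimage_algebra2 measurable_def)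
  show ?thesis
    unfolding subalgebra_def sets_natural_filtration space_natural_filtration
    using sub[OF init_measurable] sub[OF sample_measurable] sub[OF noise_measurable]
    by (intro conjI refl sets.sigma_sets_subset Un_least UN_least) auto
qed

lemma subalgebra_past_Suc: "subalgebra (past (Suc t)) (past t)"
  unfolding subalgebra_def sets_natural_filtration space_natural_filtration
  by (intro conjI refl sigma_sets_mono') fastforce

lemma grad_f_measurable [measurable]: "grad_f \<in> borel_measurable borel"
  using lipschitz by (rule borel_measurable_if_lipschitz)

lemma oracle_compose:
  assumes "X \<in> borel_measurable N" "Y \<in> measurable N S"
  shows "(\<lambda>\<omega>. G (X \<omega>) (Y \<omega>)) \<in> borel_measurable N"
  using measurable_compose[OF measurable_Pair[OF assms] oracle_measurable] by simp

lemma noise_moments: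
  assumes "1 \<le> t"
  shows "integrable M (\<lambda>\<omega>. \<zeta> t \<omega> $ i)" "(\<integral>\<omega>. \<zeta> t \<omega> $ i \<partial>M) = 0"
    "integrable M (\<lambda>\<omega>. (\<zeta> t \<omega> $ i)\<^sup>2)" "(\<integral>\<omega>. (\<zeta> t \<omega> $ i)\<^sup>2 \<partial>M) = s\<^sup>2"
proof -
  note [measurable] = noise_measurable[OF assms]
  show "integrable M (\<lambda>\<omega>. \<zeta> t \<omega> $ i)" "integrable M (\<lambda>\<omega>. (\<zeta> t \<omega> $ i)\<^sup>2)"
    using isotropic_gaussian_component_moments(1,3)[of s i]
    unfolding noise_gaussian[OF assms, symmetric] by (simp_all add: integrable_distr_eq)
  show "(\<integral>\<omega>. \<zeta> t \<omega> $ i \<partial>M) = 0" "(\<integral>\<omega>. (\<zeta> t \<omega> $ i)\<^sup>2 \<partial>M) = s\<^sup>2"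
    using isotropic_gaussian_component_moments(2,4)[of s i]
    unfolding noise_gaussian[OF assms, symmetric] by (simp_all add: integral_distr)
qed

text \<open>Independence descends to the sigma-algebras generated by \<open>\<phi>\<close> and by
  the coordinate of the noise; the expectation then factors and the noise factor is centred.\<close>

lemma noise_orthogonal:
  assumes t: "1 \<le> t" and \<phi>: "\<phi> \<in> borel_measurable (past t)" "integrable M \<phi>"
  shows "integrable M (\<lambda>\<omega>. \<phi> \<omega> * \<zeta> t \<omega> $ i) \<and> (\<integral>\<omega>. \<phi> \<omega> * \<zeta> t \<omega> $ i \<partial>M) = 0"
proof -
  have indep: "indep_var borel \<phi> borel (\<lambda>\<omega>. \<zeta> t \<omega> $ i)"
    unfolding indep_var_eq
  proof (intro conjI)
    show "\<phi> \<in> borel_measurable M" by (rule measurable_from_subalg[OF subalgebra_past \<phi>(1)])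
    show "(\<lambda>\<omega>. \<zeta> t \<omega> $ i) \<in> borel_measurable M" using noise_measurable[OF t] by measurable
    show "indep_set (sigma_sets (space M) {\<phi> -` A \<inter> space M |A. A \<in> sets borel})
        (sigma_sets (space M) {(\<lambda>\<omega>. \<zeta> t \<omega> $ i) -` A \<inter> space M |A. A \<in> sets borel})"
    proof (rule indep_set_subset[OF noise_independent[OF t]])
      have "sigma_sets (space M) {\<phi> -` A \<inter> space M |A. A \<in> sets borel} \<subseteq> sets (past t)"
        by (rule sigma_sets_vimage_subset[OF \<phi>(1)]) simp
      also have "\<dots> \<subseteq> sets (past_and_sample M S I \<xi> \<zeta> t)"
        unfolding sets_past_and_sample by (auto intro: sigma_sets.Basic)
      finally show "sigma_sets (space M) {\<phi> -` A \<inter> space M |A. A \<in> sets borel} \<subseteq> \<dots>" .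
      let ?V = "vimage_algebra (space M) (\<zeta> t) borel"
      have "\<zeta> t \<in> borel_measurable ?V" by (rule measurable_vimage_algebra1) auto
      then have "(\<lambda>\<omega>. \<zeta> t \<omega> $ i) \<in> borel_measurable ?V" by measurable
      then show "sigma_sets (space M) {(\<lambda>\<omega>. \<zeta> t \<omega> $ i) -` A \<inter> space M |A. A \<in> sets borel} \<subseteq> sets ?V"
        by (rule sigma_sets_vimage_subset) simp
    qed
  qed
  show ?thesis
    using indep_var_integrable[OF indep \<phi>(2)] indep_var_lebesgue_integral[OF indep \<phi>(2)]
      noise_moments[OF t, of i] by simp
qed

text \<open>This reduces a method to exhibiting \<open>z\<close> and \<open>m\<close> with their
  recursions. The abstract locale counts from 0 while recursions and filtration start at 1, so it is
  instantiated with all sequences shifted by one.\<close>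

lemma gradient_tendsto_0:
  fixes z m :: "nat \<Rightarrow> 'w \<Rightarrow> real ^ 'd"
  assumes const: "0 \<le> \<beta>" "\<beta> < 1" "0 < c" "0 \<le> c'"
    and init: "z 1 \<in> borel_measurable (past 1)" "m 1 \<in> borel_measurable (past 1)"
    and x: "\<And>t \<omega>. \<omega> \<in> space M \<Longrightarrow> 1 \<le> t \<Longrightarrow> x t \<omega> = z t \<omega> - c' *\<^sub>R m t \<omega>"
    and z: "\<And>t \<omega>. \<omega> \<in> space M \<Longrightarrow> 1 \<le> t \<Longrightarrow> z (Suc t) \<omega> = z t \<omega> - (c * \<alpha> t) *\<^sub>R g \<omega> t"
    and m: "\<And>t \<omega>. \<omega> \<in> space M \<Longrightarrow> 1 \<le> t \<Longrightarrow> m (Suc t) \<omega> = \<beta> *\<^sub>R m t \<omega> - \<alpha> t *\<^sub>R g \<omega> t"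
  shows "AE \<omega> in M. (\<lambda>t. norm (grad_f (x t \<omega>))) \<longlonglongrightarrow> 0"
proof -
  \<comment> \<open>The raw oracle error \<open>n\<close> is moved out of the clipped term into
    \<open>D\<close>. It is centred given the past, whereas the clipped gradient would carry an
    unknown bias.\<close>
  define n where "n t \<omega> = G (x t \<omega>) (\<xi> t \<omega>) - grad_f (x t \<omega>)" for t \<omega>
  define D where "D t \<omega> = n t \<omega> + q *\<^sub>R \<zeta> t \<omega>" for t \<omega>
  define b where "b t \<omega> = clip q (grad_f (x t \<omega>) + n t \<omega>) - n t \<omega>" for t \<omega>
  have q: "0 < q" using \<sigma>_nonneg \<sigma>_less by simp
  have g_eq: "g \<omega> t = b t \<omega> + D t \<omega>" for t \<omega>
    by (simp add: clipped_noisy_grad_def b_def D_def n_def)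
  have x_past: "x t \<in> borel_measurable (past t)"
    if t: "1 \<le> t" and "z t \<in> borel_measurable (past t)" "m t \<in> borel_measurable (past t)" for t
  proof -
    have "(\<lambda>\<omega>. z t \<omega> - c' *\<^sub>R m t \<omega>) \<in> borel_measurable (past t)" using that by measurable
    then show ?thesis by (rule measurable_cong[THEN iffD1, rotated]) (use x t in simp)
  qed
  have G_past: "(\<lambda>\<omega>. G (x t \<omega>) (\<xi> t \<omega>)) \<in> borel_measurable (past (Suc t))"
    and x_Suc: "x t \<in> borel_measurable (past (Suc t))"
    if t: "1 \<le> t" "x t \<in> borel_measurable (past t)" for t
  proof -
    show "x t \<in> borel_measurable (past (Suc t))"
      by (rule measurable_from_subalg[OF subalgebra_past_Suc t(2)])
    with t(1) show "(\<lambda>\<omega>. G (x t \<omega>) (\<xi> t \<omega>)) \<in> borel_measurable (past (Suc t))"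
      by (intro oracle_compose generator_measurable(2)) auto
  qed
  \<comment> \<open>Measurability is propagated for \<open>z\<close> and \<open>m\<close> together,
    since the next noisy gradient is taken at \<open>x\<close>, which is a combination of both. The
    recursions hold on \<open>space M\<close> only, hence the appeal to
    \<open>measurable_cong\<close>.\<close>
  have zm_past: "z t \<in> borel_measurable (past t) \<and> m t \<in> borel_measurable (past t)" if "1 \<le> t" for t
    using that
  proof (induction t rule: dec_induct)
    case (step t)
    have t: "1 \<le> t" using step by simp
    have "x t \<in> borel_measurable (past t)" using x_past[OF t] step by simp
    note [measurable] = G_past[OF t this] generator_measurable(3)[OF t lessI]
    have [measurable]: "z t \<in> borel_measurable (past (Suc t))" "m t \<in> borel_measurable (past (Suc t))"
      using step by (auto intro: measurable_from_subalg[OF subalgebra_past_Suc])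
    have [measurable]: "(\<lambda>\<omega>. g \<omega> t) \<in> borel_measurable (past (Suc t))"
      unfolding clipped_noisy_grad_def by measurable
    have "(\<lambda>\<omega>. z t \<omega> - (c * \<alpha> t) *\<^sub>R g \<omega> t) \<in> borel_measurable (past (Suc t))"
      "(\<lambda>\<omega>. \<beta> *\<^sub>R m t \<omega> - \<alpha> t *\<^sub>R g \<omega> t) \<in> borel_measurable (past (Suc t))"
      by measurable
    then show ?case
      using measurable_cong[of "past (Suc t)" "z (Suc t)" "\<lambda>\<omega>. z t \<omega> - (c * \<alpha> t) *\<^sub>R g \<omega> t" borel]
        measurable_cong[of "past (Suc t)" "m (Suc t)" "\<lambda>\<omega>. \<beta> *\<^sub>R m t \<omega> - \<alpha> t *\<^sub>R g \<omega> t" borel]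
      by (simp add: z[OF _ t] m[OF _ t])
  qed (use init in auto)
  have x_meas: "x t \<in> borel_measurable (past t)" if "1 \<le> t" for t
    using x_past zm_past that by blast
  have n_past: "n t \<in> borel_measurable (past (Suc t))" if t: "1 \<le> t" for t
  proof -
    note [measurable] = G_past[OF t x_meas[OF t]] measurable_compose[OF x_Suc[OF t x_meas[OF t]] grad_f_measurable]
    show ?thesis unfolding n_def[abs_def] by measurable
  qed
  have D_past: "D t \<in> borel_measurable (past (Suc t))" if t: "1 \<le> t" for t
    unfolding D_def[abs_def] using n_past[OF t] generator_measurable(3)[OF t lessI] by measurable
  have b_past: "b t \<in> borel_measurable (past (Suc t))" if t: "1 \<le> t" for t
  proof -
    have "b t = (\<lambda>\<omega>. clip q (G (x t \<omega>) (\<xi> t \<omega>)) - n t \<omega>)" by (auto simp: b_def n_def)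
    moreover note [measurable] = G_past[OF t x_meas[OF t]] n_past[OF t]
    ultimately show ?thesis by simp
  qed
  \<comment> \<open>The oracle values along the iterates may fail to be integrable, but their
    deviation from the conditional mean is bounded by \<open>\<sigma>\<close>.\<close>
  have n_orthogonal: "integrable M (\<lambda>\<omega>. \<phi> \<omega> * n t \<omega> $ i) \<and> (\<integral>\<omega>. \<phi> \<omega> * n t \<omega> $ i \<partial>M) = 0"
    if t: "1 \<le> t" and \<phi>: "\<phi> \<in> borel_measurable (past t)" "integrable M \<phi>" for t \<phi> i
    unfolding n_def vector_minus_component
  proof (rule integral_mult_diff_real_cond_exp[OF subalgebra_past _ _ _ _ \<phi>])
    show "(\<lambda>\<omega>. G (x t \<omega>) (\<xi> t \<omega>) $ i) \<in> borel_measurable M"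
      using measurable_from_subalg[OF subalgebra_past G_past[OF t x_meas[OF t]]] by measurable
    show "(\<lambda>\<omega>. grad_f (x t \<omega>) $ i) \<in> borel_measurable (past t)"
      using measurable_compose[OF x_meas[OF t] grad_f_measurable] by measurable
    show "AE \<omega> in M. real_cond_exp M (past t) (\<lambda>\<omega>. G (x t \<omega>) (\<xi> t \<omega>) $ i) \<omega> = grad_f (x t \<omega>) $ i"
      using unbiased[OF t] by eventually_elim (simp add: vec_cond_exp_def vec_eq_iff)
    show "AE \<omega> in M. \<bar>G (x t \<omega>) (\<xi> t \<omega>) $ i - grad_f (x t \<omega>) $ i\<bar> \<le> \<sigma>"
      using bounded_noise[OF t]
    proof eventually_elim
      case (elim \<omega>)
      then show ?case
        using component_le_norm_cart[of "G (x t \<omega>) (\<xi> t \<omega>) - grad_f (x t \<omega>)" i] by simp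
    qed
  qed
  have zeta_sq: "(norm (\<zeta> t \<omega>))\<^sup>2 = (\<Sum>i\<in>UNIV. (\<zeta> t \<omega> $ i)\<^sup>2)" for t \<omega>
    unfolding power2_norm_eq_inner inner_vec_def by (simp add: power2_eq_square)
  \<comment> \<open>The clipped part has norm at most \<open>q\<close>, and the mean square norm of
    the noise is \<open>s\<^sup>2\<close> per coordinate; the factors 2 come from
    \<open>norm_diff_square_le\<close>.\<close>
  let ?\<rho> = "2 * q\<^sup>2 + 2 * (q\<^sup>2 * (real CARD('d) * s\<^sup>2))"
  have g_sq: "integrable M (\<lambda>\<omega>. (norm (b t \<omega> + D t \<omega>))\<^sup>2)"
    "(\<integral>\<omega>. (norm (b t \<omega> + D t \<omega>))\<^sup>2 \<partial>M) \<le> ?\<rho>" if t: "1 \<le> t" for t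
  proof -
    let ?h = "\<lambda>\<omega>. 2 * q\<^sup>2 + 2 * (q\<^sup>2 * (\<Sum>i\<in>UNIV. (\<zeta> t \<omega> $ i)\<^sup>2))"
    have h: "integrable M ?h" using noise_moments[OF t] by simp
    have le: "(norm (b t \<omega> + D t \<omega>))\<^sup>2 \<le> ?h \<omega>" for \<omega>
    proof -
      have "b t \<omega> + D t \<omega> = clip q (G (x t \<omega>) (\<xi> t \<omega>)) - (- (q *\<^sub>R \<zeta> t \<omega>))"
        by (simp add: g_eq[symmetric] clipped_noisy_grad_def)
      then have "(norm (b t \<omega> + D t \<omega>))\<^sup>2
          \<le> 2 * (norm (clip q (G (x t \<omega>) (\<xi> t \<omega>))))\<^sup>2 + 2 * (norm (- (q *\<^sub>R \<zeta> t \<omega>)))\<^sup>2"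
        by (metis norm_diff_square_le)
      moreover have "(norm (clip q (G (x t \<omega>) (\<xi> t \<omega>))))\<^sup>2 \<le> q\<^sup>2"
        using q by (intro power_mono norm_clip_le) auto
      ultimately show ?thesis
        unfolding norm_minus_cancel norm_scaleR power_mult_distrib zeta_sq by simp
    qed
    have [measurable]: "b t \<in> borel_measurable M" "D t \<in> borel_measurable M"
      by (rule measurable_from_subalg[OF subalgebra_past b_past[OF t]])
        (rule measurable_from_subalg[OF subalgebra_past D_past[OF t]])
    show int: "integrable M (\<lambda>\<omega>. (norm (b t \<omega> + D t \<omega>))\<^sup>2)"
    proof (rule Bochner_Integration.integrable_bound[OF h])
      show "AE \<omega> in M. norm ((norm (b t \<omega> + D t \<omega>))\<^sup>2) \<le> norm (?h \<omega>)"
        using le by (intro AE_I2) (simp add: order_trans[OF le abs_ge_self])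
    qed measurable
    have "(\<integral>\<omega>. (norm (b t \<omega> + D t \<omega>))\<^sup>2 \<partial>M) \<le> (\<integral>\<omega>. ?h \<omega> \<partial>M)"
      by (rule integral_mono[OF int h le])
    also have "\<dots> = ?\<rho>"
      using noise_moments[OF t] by (simp add: prob_space)
    finally show "(\<integral>\<omega>. (norm (b t \<omega> + D t \<omega>))\<^sup>2 \<partial>M) \<le> ?\<rho>" .
  qed
  \<comment> \<open>\<open>max L 1\<close> is again a Lipschitz constant and is positive whatever
    \<open>L\<close> is. The bound \<open>q + \<sigma>\<close> adds the clipping level and the
    oracle error, and the descent constant is that of \<open>clip_inner_lower_bound\<close>.\<close>
  interpret noisy_momentum_descent M "\<lambda>t. past (Suc t)" f grad_f f_star "max L 1" \<beta> c c' "q + \<sigma>"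
    "min 1 ((q - \<sigma>) / (1 + \<sigma>))" ?\<rho> "\<lambda>t. \<alpha> (Suc t)" "\<lambda>t. z (Suc t)" "\<lambda>t. m (Suc t)"
    "\<lambda>t. b (Suc t)" "\<lambda>t. D (Suc t)"
  proof unfold_locales
    show "norm (grad_f w - grad_f w') \<le> max L 1 * norm (w - w')" for w w'
      using lipschitz[of w w'] mult_right_mono[of L "max L 1" "norm (w - w')"] by simp
    show "\<not> summable (\<lambda>t. \<alpha> (Suc t))"
    proof
      assume "summable (\<lambda>t. \<alpha> (Suc t))"
      then have "(\<lambda>n. \<Sum>t<n. \<alpha> (Suc t)) \<longlonglongrightarrow> (\<Sum>t. \<alpha> (Suc t))" by (rule summable_LIMSEQ)
      moreover have "(\<Sum>t<n. \<alpha> (Suc t)) = (\<Sum>t=1..n. \<alpha> t)" for n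
        by (induction n) simp_all
      ultimately show False
        using not_tendsto_and_filterlim_at_infinity[OF trivial_limit_sequentially]
          filterlim_at_top_imp_at_infinity[OF step_sum] by auto
    qed
    show "AE \<omega> in M. norm (b (Suc t) \<omega>) \<le> q + \<sigma>" for t
      using bounded_noise[of "Suc t", simplified]
    proof eventually_elim
      case (elim \<omega>)
      have "norm (b (Suc t) \<omega>) \<le> norm (clip q (grad_f (x (Suc t) \<omega>) + n (Suc t) \<omega>)) + norm (n (Suc t) \<omega>)"
        unfolding b_def by (rule norm_triangle_ineq4)
      also have "\<dots> \<le> q + \<sigma>"
        using elim q by (intro add_mono norm_clip_le) (auto simp: n_def)
      finally show ?case .
    qed
    show "AE \<omega> in M. min 1 ((q - \<sigma>) / (1 + \<sigma>)) *
        min ((norm (grad_f (z (Suc t) \<omega> - c' *\<^sub>R m (Suc t) \<omega>)))\<^sup>2)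
          (norm (grad_f (z (Suc t) \<omega> - c' *\<^sub>R m (Suc t) \<omega>)))
        \<le> inner (grad_f (z (Suc t) \<omega> - c' *\<^sub>R m (Suc t) \<omega>)) (b (Suc t) \<omega>)" for t
      using bounded_noise[of "Suc t", simplified] AE_space
    proof eventually_elim
      case (elim \<omega>)
      have eq: "z (Suc t) \<omega> - c' *\<^sub>R m (Suc t) \<omega> = x (Suc t) \<omega>" using x elim(2) by simp
      show ?case
        unfolding eq b_def by (rule clip_inner_lower_bound) (use elim \<sigma>_less in \<open>auto simp: n_def\<close>)
    qed
    show "integrable M (\<lambda>\<omega>. \<phi> \<omega> * D (Suc t) \<omega> $ i) \<and> (\<integral>\<omega>. \<phi> \<omega> * D (Suc t) \<omega> $ i \<partial>M) = 0"
      if \<phi>: "\<phi> \<in> borel_measurable (past (Suc t))" "integrable M \<phi>" for t \<phi> i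
    proof -
      have "\<phi> \<omega> * D (Suc t) \<omega> $ i = \<phi> \<omega> * n (Suc t) \<omega> $ i + q * (\<phi> \<omega> * \<zeta> (Suc t) \<omega> $ i)" for \<omega>
        by (simp add: D_def algebra_simps)
      then show ?thesis
        using n_orthogonal[OF _ \<phi>, of i] noise_orthogonal[OF _ \<phi>, of i] by simp
    qed
    show "b (Suc t) \<in> borel_measurable M" for t
      by (rule measurable_from_subalg[OF subalgebra_past b_past]) simp
  qed (use const \<sigma>_nonneg \<sigma>_less below gradient subalgebra_past subalgebra_past_Suc zm_past D_past
      g_sq z m step_pos step_square_sum in \<open>auto simp: g_eq\<close>)
  have "AE \<omega> in M. (\<lambda>t. norm (grad_f (x (Suc t) \<omega>))) \<longlonglongrightarrow> 0"
    using AE_gradient_tendsto_0 AE_space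
    by eventually_elim (use assms(7) in simp)
  then show ?thesis by eventually_elim (rule LIMSEQ_imp_Suc)
qed

end

section \<open>The three methods in momentum form\<close>

theorem theorem4:
  fixes M :: "'w measure" and S :: "'s measure"
    and f :: "real ^ 'd \<Rightarrow> real" and grad_f :: "real ^ 'd \<Rightarrow> real ^ 'd"
    and G :: "real ^ 'd \<Rightarrow> 's \<Rightarrow> real ^ 'd"
    and \<xi> :: "nat \<Rightarrow> 'w \<Rightarrow> 's"
    and \<zeta> x y :: "nat \<Rightarrow> 'w \<Rightarrow> real ^ 'd"
    and I :: "('w \<Rightarrow> real ^ 'd) set"
    and \<alpha> :: "nat \<Rightarrow> real"
    and f_star L q \<beta> \<sigma>\<^sub>g \<sigma>\<^sub>C\<^sub>N :: real
  assumes "prob_space M"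
    and f_star_le: "\<And>z. f_star \<le> f z"
    and f_star_attained: "\<exists>z. f z = f_star"
    and gradient: "\<And>z. GDERIV f z :> grad_f z"
    and lipschitz: "\<And>z w. norm (grad_f z - grad_f w) \<le> L * norm (z - w)"
    and oracle_measurable: "(\<lambda>(z, s). G z s) \<in> borel_measurable (borel \<Otimes>\<^sub>M S)"
    and sample_measurable: "\<And>t. t \<ge> 1 \<Longrightarrow> \<xi> t \<in> measurable M S"
    and noise_measurable: "\<And>t. t \<ge> 1 \<Longrightarrow> \<zeta> t \<in> borel_measurable M"
    and noise_scale: "\<sigma>\<^sub>C\<^sub>N \<ge> 0"
    and noise_gaussian: "\<And>t. t \<ge> 1 \<Longrightarrow> distr M borel (\<zeta> t) = isotropic_gaussian \<sigma>\<^sub>C\<^sub>N"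
    and noise_independent: "\<And>t. t \<ge> 1 \<Longrightarrow>
          prob_space.indep_set M (sets (past_and_sample M S I \<xi> \<zeta> t))
            (sets (vimage_algebra (space M) (\<zeta> t) borel))"
    and unbiased: "\<And>t. t \<ge> 1 \<Longrightarrow>
          AE \<omega> in M. vec_cond_exp M (natural_filtration M S I \<xi> \<zeta> t)
            (\<lambda>\<omega>'. G (x t \<omega>') (\<xi> t \<omega>')) \<omega> = grad_f (x t \<omega>)"
    and bounded_noise: "\<And>t z. t \<ge> 1 \<Longrightarrow>
          AE \<omega> in M. norm (G z (\<xi> t \<omega>) - grad_f z) \<le> \<sigma>\<^sub>g"
    and bounded_noise_iterates: "\<And>t. t \<ge> 1 \<Longrightarrow>
          AE \<omega> in M. norm (G (x t \<omega>) (\<xi> t \<omega>) - grad_f (x t \<omega>)) \<le> \<sigma>\<^sub>g"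
    and "\<sigma>\<^sub>g \<ge> 0" and "q > \<sigma>\<^sub>g" and "q > 0"
    and "0 \<le> \<beta>" and "\<beta> < 1"
    and step_pos: "\<And>t. t \<ge> 1 \<Longrightarrow> \<alpha> t > 0"
    and step_sum: "filterlim (\<lambda>n. \<Sum>t=1..n. \<alpha> t) at_top sequentially"
    and step_square_sum: "summable (\<lambda>t. (\<alpha> (t + 1))\<^sup>2)"
    and init_measurable: "\<And>Z. Z \<in> I \<Longrightarrow> Z \<in> borel_measurable M"
    and iterates:
      "(I = {x 1} \<and>
          (\<forall>\<omega>\<in>space M. sgd \<alpha> (clipped_noisy_grad q G \<xi> \<zeta> x \<omega>) (\<lambda>t. x t \<omega>))) \<or>
       (I = {x 0, x 1} \<and>
          (\<forall>\<omega>\<in>space M. shb \<alpha> \<beta> (clipped_noisy_grad q G \<xi> \<zeta> x \<omega>) (\<lambda>t. x t \<omega>))) \<or>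
       (I = {y 0, y 1} \<and>
          (\<forall>\<omega>\<in>space M. snag \<alpha> \<beta> (clipped_noisy_grad q G \<xi> \<zeta> x \<omega>) (\<lambda>t. x t \<omega>) (\<lambda>t. y t \<omega>)))"
  shows "AE \<omega> in M. (\<lambda>t. norm (grad_f (x t \<omega>))) \<longlonglongrightarrow> 0"
proof -
  interpret prob_space M by fact
  interpret clipped_noisy_oracle M S f grad_f G \<xi> \<zeta> x I \<alpha> f_star L q \<sigma>\<^sub>g \<sigma>\<^sub>C\<^sub>N
    by unfold_locales (fact | use assms in blast)+
  from iterates show ?thesis
  proof (elim disjE conjE)
    assume I: "I = {x 1}"
      and sgd: "\<forall>\<omega>\<in>space M. sgd \<alpha> (clipped_noisy_grad q G \<xi> \<zeta> x \<omega>) (\<lambda>t. x t \<omega>)"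
    \<comment> \<open>SGD is the case \<open>c' = 0\<close>, where \<open>x\<close> is
      \<open>z\<close> itself. The momentum starts at 0 because \<open>x 0\<close> is not part of
      the initialization and need not be measurable.\<close>
    define m where "m t \<omega> = (if t = 1 then 0 else x t \<omega> - x (t - 1) \<omega>)" for t \<omega>
    show ?thesis
    proof (rule gradient_tendsto_0[where \<beta> = 0 and c = 1 and c' = 0 and z = x and m = m])
      show "x (Suc t) \<omega> = x t \<omega> - (1 * \<alpha> t) *\<^sub>R g \<omega> t" if "\<omega> \<in> space M" "1 \<le> t" for t \<omega>
        using sgd that by (simp add: sgd_def)
      then show "m (Suc t) \<omega> = 0 *\<^sub>R m t \<omega> - \<alpha> t *\<^sub>R g \<omega> t" if "\<omega> \<in> space M" "1 \<le> t" for t \<omega>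
        using that by (simp add: m_def)
    qed (use generator_measurable(1) in \<open>simp_all add: I m_def[abs_def]\<close>)
  next
    assume I: "I = {x 0, x 1}"
      and shb: "\<forall>\<omega>\<in>space M. shb \<alpha> \<beta> (clipped_noisy_grad q G \<xi> \<zeta> x \<omega>) (\<lambda>t. x t \<omega>)"
    define m where "m t \<omega> = x t \<omega> - x (t - 1) \<omega>" for t \<omega>
    \<comment> \<open>Extrapolating by the geometric series of future momentum, \<open>\<beta> +
      \<beta>\<^sup>2 + \<dots> = \<beta> / (1 - \<beta>)\<close>, makes the momentum cancel, and
      \<open>z\<close> performs plain steps enlarged by \<open>1 / (1 - \<beta>)\<close>.\<close>
    define z where "z t \<omega> = x t \<omega> + (\<beta> / (1 - \<beta>)) *\<^sub>R m t \<omega>" for t \<omega>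
    have [measurable]: "x 0 \<in> borel_measurable (past 1)" "x 1 \<in> borel_measurable (past 1)"
      using generator_measurable(1) by (simp_all add: I)
    show ?thesis
    proof (rule gradient_tendsto_0[where \<beta> = \<beta> and c = "1 / (1 - \<beta>)" and c' = "\<beta> / (1 - \<beta>)"
          and z = z and m = m])
      show m_Suc: "m (Suc t) \<omega> = \<beta> *\<^sub>R m t \<omega> - \<alpha> t *\<^sub>R g \<omega> t" if "\<omega> \<in> space M" "1 \<le> t" for t \<omega>
        using shb that by (simp add: shb_def m_def)
      show "z (Suc t) \<omega> = z t \<omega> - (1 / (1 - \<beta>) * \<alpha> t) *\<^sub>R g \<omega> t"
        if "\<omega> \<in> space M" "1 \<le> t" for t \<omega>
      proof -
        have "z (Suc t) \<omega> = x t \<omega> + (1 + \<beta> / (1 - \<beta>)) *\<^sub>R m (Suc t) \<omega>"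
          by (simp add: z_def m_def scaleR_add_left)
        also have "1 + \<beta> / (1 - \<beta>) = 1 / (1 - \<beta>)" using \<open>\<beta> < 1\<close> by (simp add: field_simps)
        finally show ?thesis by (simp add: m_Suc[OF that] z_def scaleR_diff_right)
      qed
      show "z 1 \<in> borel_measurable (past 1)" "m 1 \<in> borel_measurable (past 1)"
        unfolding z_def[abs_def] m_def[abs_def] diff_self_eq_0 by measurable
    qed (use \<open>0 \<le> \<beta>\<close> \<open>\<beta> < 1\<close> in \<open>simp_all add: z_def\<close>)
  next
    assume I: "I = {y 0, y 1}"
      and snag: "\<forall>\<omega>\<in>space M. snag \<alpha> \<beta> (clipped_noisy_grad q G \<xi> \<zeta> x \<omega>) (\<lambda>t. x t \<omega>) (\<lambda>t. y t \<omega>)"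
    \<comment> \<open>For SNAG the momentum is that of \<open>y\<close>, which obeys the heavy-ball
      recursion with gradients taken at \<open>x = y + \<beta> m\<close>. Relative to
      \<open>z\<close> this point lies back by \<open>\<beta> / (1 - \<beta>) - \<beta> =
      \<beta>\<^sup>2 / (1 - \<beta>)\<close> times \<open>m\<close>.\<close>
    define m where "m t \<omega> = y t \<omega> - y (t - 1) \<omega>" for t \<omega>
    define z where "z t \<omega> = y t \<omega> + (\<beta> / (1 - \<beta>)) *\<^sub>R m t \<omega>" for t \<omega>
    have [measurable]: "y 0 \<in> borel_measurable (past 1)" "y 1 \<in> borel_measurable (past 1)"
      using generator_measurable(1) by (simp_all add: I)
    \<comment> \<open>At \<open>t = 1\<close> this is the initial condition contained in
      \<open>snag\<close>; afterwards it is the recursion for \<open>x\<close>.\<close>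
    have x_eq: "x t \<omega> = y t \<omega> + \<beta> *\<^sub>R m t \<omega>" if "\<omega> \<in> space M" "1 \<le> t" for t \<omega>
      using snag that by (cases "t = 1"; cases t) (auto simp: snag_def m_def)
    show ?thesis
    proof (rule gradient_tendsto_0[where \<beta> = \<beta> and c = "1 / (1 - \<beta>)" and c' = "\<beta>\<^sup>2 / (1 - \<beta>)"
          and z = z and m = m])
      have y_Suc: "y (Suc t) \<omega> = x t \<omega> - \<alpha> t *\<^sub>R g \<omega> t" if "\<omega> \<in> space M" "1 \<le> t" for t \<omega>
        using snag that by (simp add: snag_def)
      show m_Suc: "m (Suc t) \<omega> = \<beta> *\<^sub>R m t \<omega> - \<alpha> t *\<^sub>R g \<omega> t" if "\<omega> \<in> space M" "1 \<le> t" for t \<omega>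
        using y_Suc[OF that] x_eq[OF that] by (simp add: m_def[of "Suc t"])
      show "z (Suc t) \<omega> = z t \<omega> - (1 / (1 - \<beta>) * \<alpha> t) *\<^sub>R g \<omega> t"
        if "\<omega> \<in> space M" "1 \<le> t" for t \<omega>
      proof -
        have "z (Suc t) \<omega> = y t \<omega> + (1 + \<beta> / (1 - \<beta>)) *\<^sub>R m (Suc t) \<omega>"
          by (simp add: z_def m_def scaleR_add_left)
        also have "1 + \<beta> / (1 - \<beta>) = 1 / (1 - \<beta>)" using \<open>\<beta> < 1\<close> by (simp add: field_simps)
        finally show ?thesis by (simp add: m_Suc[OF that] z_def scaleR_diff_right)
      qed
      show "x t \<omega> = z t \<omega> - (\<beta>\<^sup>2 / (1 - \<beta>)) *\<^sub>R m t \<omega>" if "\<omega> \<in> space M" "1 \<le> t" for t \<omega>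
      proof -
        have "z t \<omega> - (\<beta>\<^sup>2 / (1 - \<beta>)) *\<^sub>R m t \<omega> = y t \<omega> + (\<beta> / (1 - \<beta>) - \<beta>\<^sup>2 / (1 - \<beta>)) *\<^sub>R m t \<omega>"
          by (simp add: z_def scaleR_diff_left)
        also have "\<beta> / (1 - \<beta>) - \<beta>\<^sup>2 / (1 - \<beta>) = \<beta>"
          unfolding diff_divide_distrib[symmetric] using \<open>\<beta> < 1\<close>
          by (simp add: nonzero_divide_eq_eq power2_eq_square right_diff_distrib)
        finally show ?thesis by (simp add: x_eq[OF that])
      qed
      show "z 1 \<in> borel_measurable (past 1)" "m 1 \<in> borel_measurable (past 1)"
        unfolding z_def[abs_def] m_def[abs_def] diff_self_eq_0 by measurable
    qed (use \<open>0 \<le> \<beta>\<close> \<open>\<beta> < 1\<close> in simp_all)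
  qed
qed

end
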